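(* Assume that $a\ge a_0$. Then there exists at most one pair of functions $(W^h,a^h)\in H_N^{1,h}(\Omega^h)\times L^{2,h}(\Omega^h)$ satisfying the equation $$D_N^h(\mathbf{x}^h)W_y^h(\mathbf{x}^h)+\sum_{i=1}^nA_i^h(\mathbf{x}^h)W_{x_i}^h(\mathbf{x}^h)+F^h(W^h(\mathbf{x}^h),\mathbf{x}^h)=0,\quad\mathbf{x}^h\in\Omega^h,$$ the boundary condition $W^h|_{\partial\Omega^h}=P^h$, and the relation $$a^h(\mathbf{x}^h)=-\frac1{2d}\int_{-d}^d\nu(\mathbf{x}^h,\alpha)\cdot\nabla_{\mathbf{x}^h}w^h(\mathbf{x}^h,\alpha)\,d\alpha+\frac1{2d}\int_{-d}^d\left(e^{-w^h(\mathbf{x}^h,\alpha)}\mu_s(\mathbf{x}^h)\int_{-d}^dK(\mathbf{x}^h,\alpha,\beta)e^{w^h(\mathbf{x}^h,\beta)}d\beta\right)d\alpha,\quad\mathbf{x}^h\in\Omega^h,$$ where $W^h=(w_0^h,\dots,w_{N-1}^h)^T$ and $w^h(\mathbf{x}^h,\alpha)=\sum_{r=0}^{N-1}w_r^h(\mathbf{x}^h)\Psi_r(\alpha)$.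
   Context: Geometry and data. $n\ge1$, $N\ge1$, $m>1$ are integers; $A,d>0$, $1<a<b$ are numbers; points of $\mathbb{R}^{n+1}$ are $\mathbf{x}=(x_1,\dots,x_n,y)$; $\Omega=\{-A<x_1,\dots,x_n<A,\ a<y<b\}$. For $\alpha\in[-d,d]$, $\mathbf{x}_\alpha=(\alpha,0,\dots,0)$ and $\nu(\mathbf{x},\alpha)=\frac{\mathbf{x}-\mathbf{x}_\alpha}{|\mathbf{x}-\mathbf{x}_\alpha|}=(\nu_1,\dots,\nu_{n+1})$. $K\ge0$, $K\in C^2(\overline\Omega\times[-d,d]^2)$; $\mu_s\in C^2(\mathbb{R}^{n+1})$, $\mu_s\ge0$, $\mu_s=0$ outside $\Omega$. Matrices and nonlinearity. $\{\Psi_r\}_{r\ge0}$ is the orthonormal basis of $L_2(-d,d)$ obtained by Gram–Schmidt from $\{\alpha^r e^\alpha\}_{r\ge0}$. For $k,r=0,\dots,N-1$ (row $k$, column $r$): $(M_N)_{kr}=\int_{-d}^d\Psi_r'\Psi_k\,d\alpha$, $(A_{n+1}(\mathbf{x}))_{kr}=\int_{-d}^d\frac{\partial_\alpha\nu_{n+1}}{\nu_{n+1}}\Psi_r\Psi_k\,d\alpha$, $(A_i(\mathbf{x}))_{kr}=\int_{-d}^d\left[\frac{\nu_i}{\nu_{n+1}}\Psi_r'+\frac{\partial_\alpha\nu_i}{\nu_{n+1}}\Psi_r\right]\Psi_k\,d\alpha$ ($i=1,\dots,n$), $D_N=M_N+A_{n+1}$. For $W=(w_0,\dots,w_{N-1})^T\in\mathbb{R}^N$,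 $F(W,\mathbf{x})\in\mathbb{R}^N$ has components $$F_k(W,\mathbf{x})=-\int_{-d}^d\frac{\mu_s(\mathbf{x})}{\nu_{n+1}(\mathbf{x},\alpha)}\,\frac{\partial}{\partial\alpha}\left[e^{-\sum_rw_r\Psi_r(\alpha)}\int_{-d}^dK(\mathbf{x},\alpha,\beta)e^{\sum_rw_r\Psi_r(\beta)}d\beta\right]\Psi_k(\alpha)\,d\alpha .$$ The number $a_0=a_0(A,d,N)>1$ is such that for all $a\ge a_0$ the matrix $D_N(\mathbf{x})$ is invertible for every $\mathbf{x}\in\overline\Omega$, with $D_N^{-1}$ bounded on $\overline\Omega$ by a constant depending only on $A,d,N,a,b,h_0,\|K\|_{C^1(\overline\Omega\times[-d,d]^2)}$. $D_N^h,A_i^h,F^h$ are the restrictions of $D_N,A_i,F$ to $\mathbf{x}=\mathbf{x}^h\in\Omega^h$ (below). Semi-discrete spaces. For $i=1,\dots,n$ let $-A=x_{i,0}<x_{i,1}<\dots<x_{i,m}=A$ be the uniform partition with step $h\ge h_0$, $h_0>0$ fixed. For $J=(j_1,\dots,j_n)\in\{0,\dots,m\}^n$ put $X_J=(x_{1,j_1},\dots,x_{n,j_n})$; $J$ is interior if $1\le j_i\le m-1$ for all $i$. $\Omega^h=\{(X_J,y):y\in(a,b)\}$, with points denoted $\mathbf{x}^h$. The boundary $\partial\Omega^h$ consists of the points $(X_J,a)$, $(X_J,b)$ and of the points $(X_J,y)$ with $J$ not interior. A semi-discrete vector function $Q^h$ is a family of functions $Q_J^h(y)=Q^h(X_J,y)\in\mathbb{R}^N$.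 At interior $J$, $Q^h_{x_k}=\frac{Q^h_{J+e_k}(y)-Q^h_{J-e_k}(y)}{2h}$, and $Q_y^h$ is the usual $y$-derivative; $\nabla_{\mathbf{x}^h}$ consists of these finite differences in $x_1,\dots,x_n$ and of $\partial_y$; all differential expressions (hence the equation and the relation for $a^h$) are considered only at interior $J$. Norms: $\|Q^h\|^2_{L_N^{2,h}(\Omega^h)}=\sum_{J\text{ interior}}\int_a^b|Q_J^h|^2dy$ ($L^{2,h}$ is the scalar version), $\|Q^h\|^2_{H_N^{1,h}(\Omega^h)}=\sum_{J\text{ interior}}\sum_{k=1}^n\int_a^b[|Q_J^h|^2+|Q_{x_k}^h(X_J,y)|^2+|\partial_yQ_J^h|^2]dy$; the spaces consist of the $Q^h$ with finite norms. $P^h$ is a given $N$-dimensional boundary vector function on $\partial\Omega^h$. *)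

theory Defs
  imports "HOL-Analysis.Analysis"
begin

text \<open>A point of the space of dimension n + 1 is a pair of \<open>(x\<^sub>1, \<dots>, x\<^sub>n) :: real^'n\<close> and \<open>y\<close>.
  The coordinate called \<open>x\<^sub>1\<close>, along which the sources move, is an index \<open>i1 :: 'n\<close>.\<close>

type_synonym 'n pnt = "(real^'n) \<times> real"

definition Omega :: "real \<Rightarrow> real \<Rightarrow> real \<Rightarrow> ('n::finite) pnt set" where
  "Omega A a b = {(x, y). (\<forall>i. - A < x $ i \<and> x $ i < A) \<and> a < y \<and> y < b}"

definition source :: "'n \<Rightarrow> real \<Rightarrow> ('n::finite) pnt" where
  "source i1 \<alpha> = (axis i1 \<alpha>, 0)"

definition nu :: "'n \<Rightarrow> 'n pnt \<Rightarrow> real \<Rightarrow> ('n::finite) pnt" where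
  "nu i1 x \<alpha> = (1 / norm (x - source i1 \<alpha>)) *\<^sub>R (x - source i1 \<alpha>)"

text \<open>Twice continuous differentiability on \<open>S\<close>, with derivatives taken within \<open>S\<close>. If \<open>S\<close> is a closed
  box with nonempty interior, this is the usual space of functions whose partial derivatives up to
  order two extend continuously from the interior to \<open>S\<close>.\<close>

definition C2_on :: "'a::real_normed_vector set \<Rightarrow> ('a \<Rightarrow> real) \<Rightarrow> bool" where
  "C2_on S f \<longleftrightarrow>
    (\<exists>(f' :: 'a \<Rightarrow> 'a \<Rightarrow>\<^sub>L real) (f'' :: 'a \<Rightarrow> 'a \<Rightarrow>\<^sub>L ('a \<Rightarrow>\<^sub>L real)).
      (\<forall>x\<in>S. (f has_derivative blinfun_apply (f' x)) (at x within S)) \<and>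
      (\<forall>x\<in>S. (f' has_derivative blinfun_apply (f'' x)) (at x within S)) \<and>
      continuous_on S f'')"

definition L2_inner :: "real \<Rightarrow> (real \<Rightarrow> real) \<Rightarrow> (real \<Rightarrow> real) \<Rightarrow> real" where
  "L2_inner d f g = integral {-d..d} (\<lambda>\<alpha>. f \<alpha> * g \<alpha>)"

function L2_gram_schmidt :: "real \<Rightarrow> (nat \<Rightarrow> real \<Rightarrow> real) \<Rightarrow> nat \<Rightarrow> real \<Rightarrow> real" where
  "L2_gram_schmidt d f r =
    (let v = (\<lambda>\<alpha>. f r \<alpha> -
           (\<Sum>j<r. L2_inner d (f r) (L2_gram_schmidt d f j) * L2_gram_schmidt d f j \<alpha>))
     in (\<lambda>\<alpha>. v \<alpha> / sqrt (L2_inner d v v)))"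
  by pat_completeness auto
termination
  by (relation "Wellfounded.measure (\<lambda>(d, f, r). r)") auto

declare L2_gram_schmidt.simps [simp del]

definition Psi :: "real \<Rightarrow> nat \<Rightarrow> real \<Rightarrow> real" where
  "Psi d = L2_gram_schmidt d (\<lambda>r \<alpha>. \<alpha> ^ r * exp \<alpha>)"

text \<open>Vectors with N components are of type \<open>real^'N\<close>; an enumeration \<open>idx\<close> of \<open>'N\<close> by
  \<open>0, \<dots>, N - 1\<close> assigns to each index the number of its basis function. In \<open>\<chi> k r. \<dots>\<close>
  the row is \<open>k\<close> and the column is \<open>r\<close>.\<close>

definition M_mat :: "('N \<Rightarrow> nat) \<Rightarrow> real \<Rightarrow> real^('N::finite)^'N" where
  "M_mat idx d = (\<chi> k r. integral {-d..d} (\<lambda>\<alpha>. deriv (Psi d (idx r)) \<alpha> * Psi d (idx k) \<alpha>))"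

definition A_last_mat ::
  "('N \<Rightarrow> nat) \<Rightarrow> 'n \<Rightarrow> real \<Rightarrow> ('n::finite) pnt \<Rightarrow> real^('N::finite)^'N" where
  "A_last_mat idx i1 d x = (\<chi> k r. integral {-d..d} (\<lambda>\<alpha>.
     deriv (\<lambda>\<alpha>. snd (nu i1 x \<alpha>)) \<alpha> / snd (nu i1 x \<alpha>) * Psi d (idx r) \<alpha> * Psi d (idx k) \<alpha>))"

definition A_mat ::
  "('N \<Rightarrow> nat) \<Rightarrow> 'n \<Rightarrow> real \<Rightarrow> 'n \<Rightarrow> ('n::finite) pnt \<Rightarrow> real^('N::finite)^'N" where
  "A_mat idx i1 d i x = (\<chi> k r. integral {-d..d} (\<lambda>\<alpha>.
     (fst (nu i1 x \<alpha>) $ i / snd (nu i1 x \<alpha>) * deriv (Psi d (idx r)) \<alpha>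
      + deriv (\<lambda>\<alpha>. fst (nu i1 x \<alpha>) $ i) \<alpha> / snd (nu i1 x \<alpha>) * Psi d (idx r) \<alpha>)
     * Psi d (idx k) \<alpha>))"

definition D_mat ::
  "('N \<Rightarrow> nat) \<Rightarrow> 'n \<Rightarrow> real \<Rightarrow> ('n::finite) pnt \<Rightarrow> real^('N::finite)^'N" where
  "D_mat idx i1 d x = M_mat idx d + A_last_mat idx i1 d x"

definition expansion :: "('N \<Rightarrow> nat) \<Rightarrow> real \<Rightarrow> real^('N::finite) \<Rightarrow> real \<Rightarrow> real" where
  "expansion idx d W \<alpha> = (\<Sum>r\<in>UNIV. W $ r * Psi d (idx r) \<alpha>)"

definition F_vec ::
  "('N \<Rightarrow> nat) \<Rightarrow> 'n \<Rightarrow> real \<Rightarrow> ('n pnt \<Rightarrow> real) \<Rightarrow> ('n pnt \<times> real \<times> real \<Rightarrow> real)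
    \<Rightarrow> real^'N \<Rightarrow> ('n::finite) pnt \<Rightarrow> real^('N::finite)" where
  "F_vec idx i1 d \<mu>s K W x = (\<chi> k. - integral {-d..d} (\<lambda>\<alpha>.
     \<mu>s x / snd (nu i1 x \<alpha>)
     * vector_derivative
         (\<lambda>\<alpha>. exp (- expansion idx d W \<alpha>)
               * integral {-d..d} (\<lambda>\<beta>. K (x, \<alpha>, \<beta>) * exp (expansion idx d W \<beta>)))
         (at \<alpha> within {-d..d})
     * Psi d (idx k) \<alpha>))"

text \<open>The matrix \<open>D_mat\<close> involves neither \<open>K\<close> nor the grid, so a bound of its inverse that holds for given
  \<open>A, d, a, b\<close> and \<open>'N\<close> depends on nothing else.\<close>

definition admissible_a0 :: "('N::finite \<Rightarrow> nat) \<Rightarrow> 'n::finite \<Rightarrow> real \<Rightarrow> real \<Rightarrow> real \<Rightarrow> bool" where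
  "admissible_a0 idx i1 A d a0 \<longleftrightarrow> 1 < a0 \<and>
    (\<forall>a\<ge>a0. \<forall>b>a.
      (\<forall>x\<in>closure (Omega A a b). invertible (D_mat idx i1 d x)) \<and>
      bounded ((\<lambda>x. matrix_inv (D_mat idx i1 d x)) ` closure (Omega A a b)))"

text \<open>A semi-discrete function is a family \<open>Q J y\<close>, the value at the point with \<open>x = node A m J\<close>.\<close>

definition step :: "real \<Rightarrow> nat \<Rightarrow> real" where
  "step A m = 2 * A / real m"

definition grid :: "nat \<Rightarrow> ('n::finite \<Rightarrow> nat) set" where
  "grid m = {J. \<forall>i. J i \<le> m}"

definition interior_grid :: "nat \<Rightarrow> ('n::finite \<Rightarrow> nat) set" where
  "interior_grid m = {J. \<forall>i. 1 \<le> J i \<and> J i \<le> m - 1}"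

definition node :: "real \<Rightarrow> nat \<Rightarrow> ('n \<Rightarrow> nat) \<Rightarrow> real^('n::finite)" where
  "node A m J = (\<chi> i. - A + real (J i) * step A m)"

definition boundary_pts :: "real \<Rightarrow> real \<Rightarrow> nat \<Rightarrow> (('n::finite \<Rightarrow> nat) \<times> real) set" where
  "boundary_pts a b m =
    {(J, y). J \<in> grid m \<and> y \<in> {a..b} \<and> (y = a \<or> y = b \<or> J \<notin> interior_grid m)}"

text \<open>The centred difference is used only at interior \<open>J\<close>, where \<open>J k - 1\<close> is not truncated.\<close>

definition diff_x ::
  "real \<Rightarrow> nat \<Rightarrow> 'n \<Rightarrow> (('n \<Rightarrow> nat) \<Rightarrow> real \<Rightarrow> 'v::real_vector) \<Rightarrow> ('n \<Rightarrow> nat) \<Rightarrow> real \<Rightarrow> 'v" where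
  "diff_x A m k Q J y = (Q (J(k := J k + 1)) y - Q (J(k := J k - 1)) y) /\<^sub>R (2 * step A m)"

definition diff_y ::
  "(('n \<Rightarrow> nat) \<Rightarrow> real \<Rightarrow> 'v::real_normed_vector) \<Rightarrow> ('n \<Rightarrow> nat) \<Rightarrow> real \<Rightarrow> 'v" where
  "diff_y Q J y = vector_derivative (Q J) (at y)"

definition grad_h ::
  "real \<Rightarrow> nat \<Rightarrow> (('n \<Rightarrow> nat) \<Rightarrow> real \<Rightarrow> real) \<Rightarrow> ('n \<Rightarrow> nat) \<Rightarrow> real \<Rightarrow> ('n::finite) pnt" where
  "grad_h A m q J y = (\<chi> k. diff_x A m k q J y, diff_y q J y)"

definition absolutely_continuous_on ::
  "real \<Rightarrow> real \<Rightarrow> (real \<Rightarrow> 'v::real_normed_vector) \<Rightarrow> bool" where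
  "absolutely_continuous_on a b f \<longleftrightarrow>
    (\<forall>\<epsilon>>0. \<exists>\<delta>>0. \<forall>\<D>. \<D> division_of (\<Union>\<D>) \<and> \<Union>\<D> \<subseteq> {a..b} \<and> (\<Sum>I\<in>\<D>. Sup I - Inf I) < \<delta>
       \<longrightarrow> (\<Sum>I\<in>\<D>. norm (f (Sup I) - f (Inf I))) < \<epsilon>)"

definition L2h_norm_sq ::
  "real \<Rightarrow> real \<Rightarrow> nat \<Rightarrow> (('n::finite \<Rightarrow> nat) \<Rightarrow> real \<Rightarrow> 'v::real_normed_vector) \<Rightarrow> ennreal" where
  "L2h_norm_sq a b m q =
    (\<Sum>J\<in>interior_grid m. \<integral>\<^sup>+ y. ennreal ((norm (q J y))\<^sup>2) \<partial>lebesgue_on {a<..<b})"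

definition H1h_norm_sq ::
  "real \<Rightarrow> real \<Rightarrow> real \<Rightarrow> nat \<Rightarrow> (('n::finite \<Rightarrow> nat) \<Rightarrow> real \<Rightarrow> 'v::real_normed_vector) \<Rightarrow> ennreal" where
  "H1h_norm_sq A a b m Q =
    (\<Sum>J\<in>interior_grid m. \<Sum>k\<in>UNIV. \<integral>\<^sup>+ y.
       ennreal ((norm (Q J y))\<^sup>2 + (norm (diff_x A m k Q J y))\<^sup>2 + (norm (diff_y Q J y))\<^sup>2)
       \<partial>lebesgue_on {a<..<b})"

definition L2h_space ::
  "real \<Rightarrow> real \<Rightarrow> nat \<Rightarrow> (('n::finite \<Rightarrow> nat) \<Rightarrow> real \<Rightarrow> 'v::euclidean_space) set" where
  "L2h_space a b m = {q.
    (\<forall>J\<in>interior_grid m. q J \<in> borel_measurable (lebesgue_on {a<..<b})) \<and>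
    L2h_norm_sq a b m q < \<infinity>}"

text \<open>Elements of the first-order space are given by the representative that is absolutely continuous
  in \<open>y\<close> up to the end points, so that boundary values at \<open>y = a\<close> and \<open>y = b\<close> make sense; the derivative
  in \<open>y\<close> is the usual one and exists almost everywhere (which absolute continuity entails).\<close>

definition H1h_space ::
  "real \<Rightarrow> real \<Rightarrow> real \<Rightarrow> nat \<Rightarrow> (('n::finite \<Rightarrow> nat) \<Rightarrow> real \<Rightarrow> 'v::euclidean_space) set" where
  "H1h_space A a b m = {Q.
    (\<forall>J\<in>interior_grid m.
       absolutely_continuous_on a b (Q J) \<and>
       (AE y in lebesgue_on {a<..<b}. Q J differentiable (at y)) \<and>
       diff_y Q J \<in> borel_measurable (lebesgue_on {a<..<b}) \<and>
       (\<forall>k. diff_x A m k Q J \<in> borel_measurable (lebesgue_on {a<..<b}))) \<and>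
    H1h_norm_sq A a b m Q < \<infinity>}"

definition solves_system ::
  "('N::finite \<Rightarrow> nat) \<Rightarrow> 'n::finite \<Rightarrow> real \<Rightarrow> real \<Rightarrow> real \<Rightarrow> real \<Rightarrow> nat
    \<Rightarrow> ('n pnt \<Rightarrow> real) \<Rightarrow> ('n pnt \<times> real \<times> real \<Rightarrow> real)
    \<Rightarrow> (('n \<Rightarrow> nat) \<Rightarrow> real \<Rightarrow> real^'N) \<Rightarrow> bool" where
  "solves_system idx i1 A d a b m \<mu>s K W \<longleftrightarrow>
    (\<forall>J\<in>interior_grid m. AE y in lebesgue_on {a<..<b}.
       (let x = (node A m J, y) in
        D_mat idx i1 d x *v diff_y W J y
        + (\<Sum>i\<in>UNIV. A_mat idx i1 d i x *v diff_x A m i W J y)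
        + F_vec idx i1 d \<mu>s K (W J y) x = 0))"

definition absorption_relation ::
  "('N::finite \<Rightarrow> nat) \<Rightarrow> 'n::finite \<Rightarrow> real \<Rightarrow> real \<Rightarrow> real \<Rightarrow> real \<Rightarrow> nat
    \<Rightarrow> ('n pnt \<Rightarrow> real) \<Rightarrow> ('n pnt \<times> real \<times> real \<Rightarrow> real)
    \<Rightarrow> (('n \<Rightarrow> nat) \<Rightarrow> real \<Rightarrow> real^'N) \<Rightarrow> (('n \<Rightarrow> nat) \<Rightarrow> real \<Rightarrow> real) \<Rightarrow> bool" where
  "absorption_relation idx i1 A d a b m \<mu>s K W ah \<longleftrightarrow>
    (\<forall>J\<in>interior_grid m. AE y in lebesgue_on {a<..<b}.
       (let x = (node A m J, y); w = (\<lambda>\<alpha> J y. expansion idx d (W J y) \<alpha>) in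
        ah J y =
          - (1 / (2 * d)) * integral {-d..d} (\<lambda>\<alpha>. nu i1 x \<alpha> \<bullet> grad_h A m (w \<alpha>) J y)
          + 1 / (2 * d) * integral {-d..d} (\<lambda>\<alpha>. exp (- w \<alpha> J y) * \<mu>s x
              * integral {-d..d} (\<lambda>\<beta>. K (x, \<alpha>, \<beta>) * exp (w \<beta> J y)))))"

definition is_solution ::
  "('N::finite \<Rightarrow> nat) \<Rightarrow> 'n::finite \<Rightarrow> real \<Rightarrow> real \<Rightarrow> real \<Rightarrow> real \<Rightarrow> nat
    \<Rightarrow> ('n pnt \<Rightarrow> real) \<Rightarrow> ('n pnt \<times> real \<times> real \<Rightarrow> real)
    \<Rightarrow> (('n \<Rightarrow> nat) \<Rightarrow> real \<Rightarrow> real^'N)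
    \<Rightarrow> (('n \<Rightarrow> nat) \<Rightarrow> real \<Rightarrow> real^'N) \<Rightarrow> (('n \<Rightarrow> nat) \<Rightarrow> real \<Rightarrow> real) \<Rightarrow> bool" where
  "is_solution idx i1 A d a b m \<mu>s K P W ah \<longleftrightarrow>
    W \<in> H1h_space A a b m \<and> ah \<in> L2h_space a b m \<and>
    solves_system idx i1 A d a b m \<mu>s K W \<and>
    (\<forall>(J, y)\<in>boundary_pts a b m. W J y = P J y) \<and>
    absorption_relation idx i1 A d a b m \<mu>s K W ah"

end

(* On a fixed grid in the x-variables the system is an ordinary differential system in y for the
   finitely many interior nodes: D_N is boundedly invertible, the centred differences are bounded
   operators because the step is fixed, and F is Lipschitz in W on bounded sets. So the difference Z
   of two solutions satisfies |Z_y| <= C * (sum over the interior nodes of |Z|) almost everywhere,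
   with Z = 0 at y = a, and Gronwall's inequality for absolutely continuous functions gives Z = 0. *)
theory Submission
  imports Defs
begin

subsection \<open>Absolutely continuous functions and a Gronwall inequality\<close>

text \<open>The derivative in y exists only almost everywhere, so a classical uniqueness theorem for
  C^1 solutions does not apply. The Gronwall step rests instead on a mean value inequality proved by
  a gauge argument straight from the definition of absolute continuity by divisions; no integral of
  the derivative is ever formed. The exponentials make F only locally Lipschitz. The radius of the
  ball is taken from the two given solutions, which are continuous on the compact interval [a, b];
  the constant C thus depends on the pair, which is harmless for uniqueness. The derivative in
  \<alpha> inside F does not fall on W: under the integral in \<beta> it leaves an explicit kernel
  in which W occurs only through its finite expansion and the derivative of that expansion. The
  system in y closes because both solutions agree at the nodes that are not interior, so the
  interior values of Z control every neighbour used by a centred difference. Since y >= a > 1 on the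
  closed box while the sources have y = 0, \<open>nu\<close> is smooth there and its last component
  is positive.\<close>

lemma absolutely_continuous_on_subinterval:
  assumes "absolutely_continuous_on a b f" and "a \<le> a'" and "b' \<le> b"
  shows "absolutely_continuous_on a' b' f"
proof -
  have "{a'..b'} \<subseteq> {a..b}"
    using assms by auto
  then show ?thesis
    using assms(1) unfolding absolutely_continuous_on_def by (meson order_trans)
qed

lemma absolutely_continuous_on_diff:
  assumes f: "absolutely_continuous_on a b f" and g: "absolutely_continuous_on a b g"
  shows "absolutely_continuous_on a b (\<lambda>x. f x - g x)"
  unfolding absolutely_continuous_on_def
proof (intro allI impI)
  fix \<epsilon> :: real
  assume "\<epsilon> > 0"
  then have e2: "\<epsilon> / 2 > 0" by simp
  from f e2 obtain \<delta>1 where "\<delta>1 > 0"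
    and f': "\<And>\<D>. \<D> division_of (\<Union>\<D>) \<Longrightarrow> \<Union>\<D> \<subseteq> {a..b} \<Longrightarrow> (\<Sum>I\<in>\<D>. Sup I - Inf I) < \<delta>1
       \<Longrightarrow> (\<Sum>I\<in>\<D>. norm (f (Sup I) - f (Inf I))) < \<epsilon> / 2"
    unfolding absolutely_continuous_on_def by meson
  from g e2 obtain \<delta>2 where "\<delta>2 > 0"
    and g': "\<And>\<D>. \<D> division_of (\<Union>\<D>) \<Longrightarrow> \<Union>\<D> \<subseteq> {a..b} \<Longrightarrow> (\<Sum>I\<in>\<D>. Sup I - Inf I) < \<delta>2
       \<Longrightarrow> (\<Sum>I\<in>\<D>. norm (g (Sup I) - g (Inf I))) < \<epsilon> / 2"
    unfolding absolutely_continuous_on_def by meson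
  show "\<exists>\<delta>>0. \<forall>\<D>. \<D> division_of (\<Union>\<D>) \<and> \<Union>\<D> \<subseteq> {a..b} \<and> (\<Sum>I\<in>\<D>. Sup I - Inf I) < \<delta>
       \<longrightarrow> (\<Sum>I\<in>\<D>. norm (f (Sup I) - g (Sup I) - (f (Inf I) - g (Inf I)))) < \<epsilon>"
  proof (intro exI[of _ "min \<delta>1 \<delta>2"] conjI allI impI)
    show "min \<delta>1 \<delta>2 > 0" using \<open>\<delta>1 > 0\<close> \<open>\<delta>2 > 0\<close> by simp
    fix \<D> :: "real set set"
    assume \<D>: "\<D> division_of (\<Union>\<D>) \<and> \<Union>\<D> \<subseteq> {a..b} \<and> (\<Sum>I\<in>\<D>. Sup I - Inf I) < min \<delta>1 \<delta>2"
    have "(\<Sum>I\<in>\<D>. norm (f (Sup I) - g (Sup I) - (f (Inf I) - g (Inf I))))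
        \<le> (\<Sum>I\<in>\<D>. norm (f (Sup I) - f (Inf I)) + norm (g (Sup I) - g (Inf I)))"
    proof (rule sum_mono)
      fix I :: "real set"
      have "f (Sup I) - g (Sup I) - (f (Inf I) - g (Inf I))
          = (f (Sup I) - f (Inf I)) - (g (Sup I) - g (Inf I))" by simp
      then show "norm (f (Sup I) - g (Sup I) - (f (Inf I) - g (Inf I)))
          \<le> norm (f (Sup I) - f (Inf I)) + norm (g (Sup I) - g (Inf I))"
        by (metis norm_triangle_ineq4)
    qed
    also have "\<dots> < \<epsilon>"
      using f'[of \<D>] g'[of \<D>] \<D> by (simp add: sum.distrib)
    finally show "(\<Sum>I\<in>\<D>. norm (f (Sup I) - g (Sup I) - (f (Inf I) - g (Inf I)))) < \<epsilon>" .
  qed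
qed

section \<open>Increments of absolutely continuous functions and a mean value inequality\<close>

lemma absolutely_continuous_on_imp_continuous_on:
  assumes "absolutely_continuous_on a b f"
  shows "continuous_on {a..b} f"
  unfolding continuous_on_iff
proof (intro ballI allI impI)
  fix x \<epsilon> :: real
  assume x: "x \<in> {a..b}" and "\<epsilon> > 0"
  with assms obtain \<delta> where "\<delta> > 0"
    and \<delta>: "\<And>\<D>. \<D> division_of (\<Union>\<D>) \<Longrightarrow> \<Union>\<D> \<subseteq> {a..b} \<Longrightarrow> (\<Sum>I\<in>\<D>. Sup I - Inf I) < \<delta>
       \<Longrightarrow> (\<Sum>I\<in>\<D>. norm (f (Sup I) - f (Inf I))) < \<epsilon>"
    unfolding absolutely_continuous_on_def by meson
  have *: "norm (f v - f u) < \<epsilon>" if "u \<le> v" "u \<in> {a..b}" "v \<in> {a..b}" "v - u < \<delta>" for u v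
  proof -
    have "{{u..v}} division_of \<Union>{{u..v}}"
      using that division_of_self[of u v] by simp
    then show ?thesis
      using \<delta>[of "{{u..v}}"] that by auto
  qed
  show "\<exists>\<delta>>0. \<forall>y\<in>{a..b}. dist y x < \<delta> \<longrightarrow> dist (f y) (f x) < \<epsilon>"
  proof (intro exI[of _ \<delta>] conjI ballI impI \<open>\<delta> > 0\<close>)
    fix y assume y: "y \<in> {a..b}" "dist y x < \<delta>"
    show "dist (f y) (f x) < \<epsilon>"
      using *[of x y] *[of y x] x y
      by (cases "x \<le> y") (auto simp: dist_norm norm_minus_commute)
  qed
qed

text \<open>A null set has an open neighbourhood \<open>U\<close> of measure below the \<delta> of
  absolute continuity. The cells of a partial division do not overlap, so cells inside
  \<open>U\<close> have total length at most the measure of \<open>U\<close>. This disposes of the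
  points where nothing is known about the derivative.\<close>

lemma absolutely_continuous_on_small_near_null:
  assumes f: "absolutely_continuous_on a b f" and E: "negligible E" and "\<epsilon> > 0"
  shows "\<exists>U. open U \<and> E \<subseteq> U \<and>
    (\<forall>p. p tagged_partial_division_of {a..b} \<and> (\<forall>(x, K)\<in>p. K \<subseteq> U) \<longrightarrow>
      (\<Sum>(x, K)\<in>p. norm (f (Sup K) - f (Inf K))) < \<epsilon>)"
proof -
  from f \<open>\<epsilon> > 0\<close> obtain \<delta> where "\<delta> > 0"
    and \<delta>: "\<And>\<D>. \<D> division_of (\<Union>\<D>) \<Longrightarrow> \<Union>\<D> \<subseteq> {a..b} \<Longrightarrow> (\<Sum>I\<in>\<D>. Sup I - Inf I) < \<delta>
       \<Longrightarrow> (\<Sum>I\<in>\<D>. norm (f (Sup I) - f (Inf I))) < \<epsilon>"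
    unfolding absolutely_continuous_on_def by meson
  have "E \<in> sets lebesgue"
    using E negligible_imp_sets by blast
  then obtain U where U: "open U" "E \<subseteq> U" "U - E \<in> lmeasurable"
      "emeasure lebesgue (U - E) < ennreal \<delta>"
    using sets_lebesgue_outer_open[OF _ \<open>\<delta> > 0\<close>] by metis
  \<comment> \<open>Outer regularity bounds only the measure of \<open>U - E\<close>; as
    \<open>E\<close> is null, the bound passes to \<open>U\<close>.\<close>
  have "U = (U - E) \<union> E" using U(2) by auto
  then have lU: "U \<in> lmeasurable" "emeasure lebesgue U < ennreal \<delta>"
    using U(3,4) E
    by (metis fmeasurable.Un negligible_imp_measurable,
        metis emeasure_Un_null_set fmeasurableD negligible_iff_null_sets)
  have mU: "measure lebesgue U < \<delta>"
    using lU by (metis \<open>\<delta> > 0\<close> emeasure_eq_measure2 ennreal_less_iff measure_nonneg)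
  show ?thesis
  proof (intro exI[of _ U] conjI allI impI U(1,2))
    fix p
    assume "p tagged_partial_division_of {a..b} \<and> (\<forall>(x, K)\<in>p. K \<subseteq> U)"
    then have p: "p tagged_partial_division_of {a..b}" and pU: "\<And>x K. (x, K) \<in> p \<Longrightarrow> K \<subseteq> U"
      by auto
    define \<D> where "\<D> = snd ` p"
    have div: "\<D> division_of \<Union>\<D>"
      unfolding \<D>_def by (rule partial_division_of_tagged_division[OF p])
    have sub: "\<Union>\<D> \<subseteq> {a..b}"
      using tagged_partial_division_ofD(3)[OF p] unfolding \<D>_def by force
    have ne: "K \<noteq> {}" "\<exists>u v. K = {u..v}" if "K \<in> \<D>" for K
      using division_ofD(3,4)[OF div that] by auto
    have "(\<Sum>I\<in>\<D>. Sup I - Inf I) = (\<Sum>I\<in>\<D>. measure lebesgue I)"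
    proof (rule sum.cong[OF refl])
      fix I assume "I \<in> \<D>"
      then obtain u v where uv: "I = {u..v}" using ne(2) by blast
      then have "u \<le> v" using ne(1)[OF \<open>I \<in> \<D>\<close>] by simp
      with uv show "Sup I - Inf I = measure lebesgue I" by simp
    qed
    also have "\<dots> = measure lebesgue (\<Union>\<D>)"
      by (rule content_division[OF div])
    also have "\<dots> \<le> measure lebesgue U"
    proof (rule measure_mono_fmeasurable)
      show "\<Union>\<D> \<subseteq> U" using pU by (fastforce simp: \<D>_def)
    qed (use lU(1) lmeasurable_division[OF div] in auto)
    also have "\<dots> < \<delta>" by (rule mU)
    finally have small: "(\<Sum>I\<in>\<D>. norm (f (Sup I) - f (Inf I))) < \<epsilon>"
      using \<delta>[OF div sub] by simp
    \<comment> \<open>To pass from tagged cells to the set of cells, the summand has to vanish on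
      every box with empty interior, the empty box included, where \<open>Sup\<close> and
      \<open>Inf\<close> have no useful value. The case distinction puts 0 there and changes
      nothing, since no cell is empty.\<close>
    have "(\<Sum>(x, K)\<in>p. norm (f (Sup K) - f (Inf K)))
        = (\<Sum>(x, K)\<in>p. if K = {} then 0 else norm (f (Sup K) - f (Inf K)))"
      using ne(1) by (intro sum.cong refl) (force simp: \<D>_def)
    also have "\<dots> = (\<Sum>K\<in>\<D>. if K = {} then 0 else norm (f (Sup K) - f (Inf K)))"
      unfolding \<D>_def
      by (rule sum.over_tagged_division_lemma[OF tagged_partial_division_of_Union_self[OF p]])
         (auto simp: not_less dest: antisym)
    also have "\<dots> = (\<Sum>I\<in>\<D>. norm (f (Sup I) - f (Inf I)))"
      using ne(1) by (intro sum.cong) auto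
    finally show "(\<Sum>(x, K)\<in>p. norm (f (Sup K) - f (Inf K))) < \<epsilon>"
      using small by simp
  qed
qed

text \<open>The straddle lemma of gauge integration: as x lies between u and v, the first-order
  errors at u and at v add up to a multiple of v - u. Half of \<epsilon> pays for \<open>f\<close>
  and half for \<open>g\<close>.\<close>

lemma has_vector_derivative_bound_nearby:
  fixes f :: "real \<Rightarrow> 'v::real_normed_vector" and g :: "real \<Rightarrow> real"
  assumes f: "(f has_vector_derivative f') (at x within S)"
    and g: "(g has_vector_derivative g') (at x within S)"
    and "norm f' \<le> g'" and "\<epsilon> > 0"
  obtains r where "r > 0"
    and "\<And>u v. u \<le> x \<Longrightarrow> x \<le> v \<Longrightarrow> u \<in> S \<Longrightarrow> v \<in> S \<Longrightarrow> {u..v} \<subseteq> ball x r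
      \<Longrightarrow> norm (f v - f u) \<le> g v - g u + \<epsilon> * (v - u)"
proof -
  have e2: "\<epsilon> / 2 > 0" using \<open>\<epsilon> > 0\<close> by simp
  obtain r1 where r1: "r1 > 0" "\<And>y. y \<in> S \<Longrightarrow> norm (y - x) < r1 \<Longrightarrow>
      norm (f y - f x - (y - x) *\<^sub>R f') \<le> \<epsilon> / 2 * norm (y - x)"
    using f e2 unfolding has_vector_derivative_def has_derivative_within_alt by blast
  obtain r2 where r2: "r2 > 0" "\<And>y. y \<in> S \<Longrightarrow> norm (y - x) < r2 \<Longrightarrow>
      norm (g y - g x - (y - x) *\<^sub>R g') \<le> \<epsilon> / 2 * norm (y - x)"
    using g e2 unfolding has_vector_derivative_def has_derivative_within_alt by blast
  show thesis
  proof (rule that[of "min r1 r2"])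
    show "min r1 r2 > 0" using r1 r2 by simp
    fix u v
    assume uv: "u \<le> x" "x \<le> v" "u \<in> S" "v \<in> S" "{u..v} \<subseteq> ball x (min r1 r2)"
    moreover have "u \<in> {u..v}" "v \<in> {u..v}" using uv by auto
    ultimately have "u \<in> ball x (min r1 r2)" "v \<in> ball x (min r1 r2)" by blast+
    then have "\<bar>u - x\<bar> < min r1 r2" "\<bar>v - x\<bar> < min r1 r2"
      by (auto simp: dist_real_def abs_minus_commute)
    then have fu: "norm (f u - f x - (u - x) *\<^sub>R f') \<le> \<epsilon> / 2 * (x - u)"
      and fv: "norm (f v - f x - (v - x) *\<^sub>R f') \<le> \<epsilon> / 2 * (v - x)"
      and gu: "\<bar>g u - g x - (u - x) * g'\<bar> \<le> \<epsilon> / 2 * (x - u)"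
      and gv: "\<bar>g v - g x - (v - x) * g'\<bar> \<le> \<epsilon> / 2 * (v - x)"
      using r1(2)[of u] r1(2)[of v] r2(2)[of u] r2(2)[of v] uv by auto
    have "f v - f u = (f v - f x - (v - x) *\<^sub>R f') - (f u - f x - (u - x) *\<^sub>R f') + (v - u) *\<^sub>R f'"
      by (simp add: algebra_simps)
    then have "norm (f v - f u) \<le> norm (f v - f x - (v - x) *\<^sub>R f')
        + norm (f u - f x - (u - x) *\<^sub>R f') + norm ((v - u) *\<^sub>R f')"
      by (metis norm_triangle_mono norm_triangle_ineq4 order_refl)
    also have "\<dots> \<le> \<epsilon> / 2 * (v - x) + \<epsilon> / 2 * (x - u) + (v - u) * g'"
      using fu fv \<open>norm f' \<le> g'\<close> uv by (intro add_mono) (auto intro!: mult_left_mono)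
    also have "\<dots> \<le> g v - g u + \<epsilon> * (v - u)"
    proof -
      have "(v - u) * g' = (v - x) * g' - (u - x) * g'" "\<epsilon> * (v - u) = 2 * (\<epsilon> / 2 * (v - x)) + 2 * (\<epsilon> / 2 * (x - u))"
        by (simp_all add: field_simps)
      then show ?thesis
        using gu gv unfolding abs_le_iff by linarith
    qed
    finally show "norm (f v - f u) \<le> g v - g u + \<epsilon> * (v - u)" .
  qed
qed

text \<open>By Cousin's lemma, pick a division that is fine for a gauge which controls the increments by
  the derivatives at tags outside \<open>E\<close> and keeps the intervals tagged in \<open>E\<close> inside a small open
  set, where absolute continuity takes over.\<close>

lemma absolutely_continuous_mean_value_bound:
  fixes f :: "real \<Rightarrow> 'v::real_normed_vector" and g g' :: "real \<Rightarrow> real"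
  assumes "a \<le> b" and f: "absolutely_continuous_on a b f" and E: "negligible E"
    and f': "\<And>x. x \<in> {a..b} - E \<Longrightarrow> (f has_vector_derivative f' x) (at x within {a..b})"
    and g': "\<And>x. x \<in> {a..b} - E \<Longrightarrow> (g has_vector_derivative g' x) (at x within {a..b})"
    and le: "\<And>x. x \<in> {a..b} - E \<Longrightarrow> norm (f' x) \<le> g' x"
    and mono: "mono_on {a..b} g"
  shows "norm (f b - f a) \<le> g b - g a"
proof (rule field_le_epsilon)
  fix e :: real
  assume "e > 0"
  \<comment> \<open>Cells tagged outside \<open>E\<close> cost \<epsilon> (b - a) in total and cells
    tagged in \<open>E\<close> cost at most \<epsilon>; the two together make e.\<close>
  define \<epsilon> where "\<epsilon> = e / (1 + (b - a))"
  have "\<epsilon> > 0" using \<open>e > 0\<close> \<open>a \<le> b\<close> by (simp add: \<epsilon>_def)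
  obtain U where U: "open U" "E \<subseteq> U"
    and smallU: "\<And>p. p tagged_partial_division_of {a..b} \<Longrightarrow> \<forall>(x, K)\<in>p. K \<subseteq> U
      \<Longrightarrow> (\<Sum>(x, K)\<in>p. norm (f (Sup K) - f (Inf K))) < \<epsilon>"
    using absolutely_continuous_on_small_near_null[OF f E \<open>\<epsilon> > 0\<close>] by blast
  \<comment> \<open>The condition is void at the exceptional points, so that the choice of radii is
    a total positive function, as a gauge requires.\<close>
  have "\<forall>x. \<exists>r>0. x \<in> {a..b} - E \<longrightarrow> (\<forall>u v. u \<le> x \<and> x \<le> v \<and> u \<in> {a..b} \<and> v \<in> {a..b}
      \<and> {u..v} \<subseteq> ball x r \<longrightarrow> norm (f v - f u) \<le> g v - g u + \<epsilon> * (v - u))"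
  proof
    fix x
    show "\<exists>r>0. x \<in> {a..b} - E \<longrightarrow> (\<forall>u v. u \<le> x \<and> x \<le> v \<and> u \<in> {a..b} \<and> v \<in> {a..b}
      \<and> {u..v} \<subseteq> ball x r \<longrightarrow> norm (f v - f u) \<le> g v - g u + \<epsilon> * (v - u))"
    proof (cases "x \<in> {a..b} - E")
      case True
      show ?thesis
        by (rule has_vector_derivative_bound_nearby[OF f'[OF True] g'[OF True] le[OF True] \<open>\<epsilon> > 0\<close>])
           blast
    next
      case False
      then show ?thesis by (meson zero_less_one)
    qed
  qed
  then obtain r where r: "\<And>x. r x > 0"
    and rb: "\<And>x u v. x \<in> {a..b} - E \<Longrightarrow> u \<le> x \<Longrightarrow> x \<le> v \<Longrightarrow> u \<in> {a..b} \<Longrightarrow> v \<in> {a..b}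
      \<Longrightarrow> {u..v} \<subseteq> ball x (r x) \<Longrightarrow> norm (f v - f u) \<le> g v - g u + \<epsilon> * (v - u)"
    by metis
  define \<gamma> where "\<gamma> x = (if x \<in> E then U else ball x (r x))" for x
  have "gauge \<gamma>"
    unfolding gauge_def \<gamma>_def using U r by auto
  then obtain p where p: "p tagged_division_of {a..b}" and fine: "\<gamma> fine p"
    using fine_division_exists_real by blast
  define q where "q = {(x, K) \<in> p. x \<in> E}"
  have "finite p" and "q \<subseteq> p" using p by (auto simp: q_def)
  have cell: "\<exists>u v. K = {u..v} \<and> u \<le> x \<and> x \<le> v \<and> u \<in> {a..b} \<and> v \<in> {a..b} \<and> {u..v} \<subseteq> \<gamma> x"
    if "(x, K) \<in> p" for x K
  proof -
    have "x \<in> K" "K \<subseteq> {a..b}" "\<exists>u v. K = cbox u v" "K \<subseteq> \<gamma> x"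
      using tagged_division_ofD(2-4)[OF p that] fine that unfolding fine_def by auto
    then show ?thesis by fastforce
  qed
  have "q tagged_partial_division_of {a..b}"
    using p \<open>q \<subseteq> p\<close> by (meson tagged_division_of_def tagged_partial_division_subset)
  moreover have "\<forall>(x, K)\<in>q. K \<subseteq> U"
    using cell by (fastforce simp: q_def \<gamma>_def)
  ultimately have qsmall: "(\<Sum>(x, K)\<in>q. norm (f (Sup K) - f (Inf K))) < \<epsilon>"
    by (rule smallU)
  let ?G = "\<lambda>(x, K). g (Sup K) - g (Inf K) + \<epsilon> * (Sup K - Inf K)"
  have "f b - f a = (\<Sum>(x, K)\<in>p. f (Sup K) - f (Inf K))"
    using additive_tagged_division_1[OF \<open>a \<le> b\<close> p, of f] by simp
  then have "norm (f b - f a) \<le> (\<Sum>(x, K)\<in>p. norm (f (Sup K) - f (Inf K)))"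
    by (simp add: split_def norm_sum)
  also have "\<dots> \<le> (\<Sum>xK\<in>p. ?G xK + (if fst xK \<in> E then norm (f (Sup (snd xK)) - f (Inf (snd xK))) else 0))"
  proof (rule sum_mono)
    fix xK assume "xK \<in> p"
    then obtain x u v where xK: "xK = (x, {u..v})" "(x, {u..v}) \<in> p" "u \<le> x" "x \<le> v"
        "u \<in> {a..b}" "v \<in> {a..b}" "{u..v} \<subseteq> \<gamma> x"
      using cell by (metis surj_pair)
    \<comment> \<open>On a cell tagged in \<open>E\<close> nothing relates \<open>g\<close> to
      \<open>f\<close>; monotonicity makes \<open>?G\<close> nonnegative there, so it can be
      included in the bound and the sum of \<open>?G\<close> can run over all of
      \<open>p\<close>.\<close>
    have "g u \<le> g v" using mono xK by (meson mono_onD order_trans)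
    moreover have "\<epsilon> * (v - u) \<ge> 0" using xK \<open>\<epsilon> > 0\<close> by simp
    ultimately show "(case xK of (x, K) \<Rightarrow> norm (f (Sup K) - f (Inf K)))
        \<le> ?G xK + (if fst xK \<in> E then norm (f (Sup (snd xK)) - f (Inf (snd xK))) else 0)"
      using xK rb[of x u v] by (auto simp: \<gamma>_def)
  qed
  also have "\<dots> = (\<Sum>xK\<in>p. ?G xK) + (\<Sum>(x, K)\<in>q. norm (f (Sup K) - f (Inf K)))"
  proof -
    have "(\<Sum>(x, K)\<in>q. norm (f (Sup K) - f (Inf K)))
        = (\<Sum>xK\<in>p. if fst xK \<in> E then norm (f (Sup (snd xK)) - f (Inf (snd xK))) else 0)"
      using \<open>finite p\<close> \<open>q \<subseteq> p\<close> by (intro sum.mono_neutral_cong_left) (auto simp: q_def)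
    then show ?thesis by (simp add: sum.distrib)
  qed
  also have "(\<Sum>xK\<in>p. ?G xK) = g b - g a + \<epsilon> * (b - a)"
  proof -
    \<comment> \<open>\<open>?G\<close> is the increment of y \<mapsto> g y + \<epsilon> y over a
      cell, hence the sum telescopes.\<close>
    have "(\<Sum>xK\<in>p. ?G xK) = (\<Sum>(x, K)\<in>p. (g (Sup K) + \<epsilon> * Sup K) - (g (Inf K) + \<epsilon> * Inf K))"
      by (intro sum.cong) (auto simp: algebra_simps)
    also have "\<dots> = (g b + \<epsilon> * b) - (g a + \<epsilon> * a)"
      by (rule additive_tagged_division_1[OF \<open>a \<le> b\<close> p])
    finally show ?thesis by (simp add: algebra_simps)
  qed
  finally have "norm (f b - f a) \<le> g b - g a + \<epsilon> * (b - a) + \<epsilon>"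
    using qsmall by linarith
  also have "\<dots> = g b - g a + e"
  proof -
    have "\<epsilon> * (1 + (b - a)) = e" using \<open>a \<le> b\<close> by (simp add: \<epsilon>_def)
    then show ?thesis by (simp add: algebra_simps)
  qed
  finally show "norm (f b - f a) \<le> g b - g a + e" .
qed

text \<open>The weight \<open>exp (- \<kappa> (y - a))\<close> with \<open>\<kappa> > 2 C card I\<close> makes the integrated inequality a
  contraction: at the maximum \<open>S\<close> of the weighted sum of norms it yields \<open>S \<le> S / 2\<close>.\<close>

lemma gronwall_family_zero:
  fixes Z :: "'j \<Rightarrow> real \<Rightarrow> 'v::real_normed_vector"
  assumes "finite I" and "0 \<le> C" and "a \<le> b"
    and AC: "\<And>J. J \<in> I \<Longrightarrow> absolutely_continuous_on a b (Z J)"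
    and init: "\<And>J. J \<in> I \<Longrightarrow> Z J a = 0"
    and der: "AE y in lebesgue_on {a<..<b}. \<forall>J\<in>I. Z J differentiable (at y) \<and>
      norm (vector_derivative (Z J) (at y)) \<le> C * (\<Sum>J'\<in>I. norm (Z J' y))"
    and "J \<in> I" and "y \<in> {a..b}"
  shows "Z J y = 0"
proof -
  define \<phi> where "\<phi> y = (\<Sum>J\<in>I. norm (Z J y))" for y
  \<comment> \<open>The summand 1 keeps \<kappa> positive also when \<open>C\<close> is 0 or
    \<open>I\<close> is empty.\<close>
  define \<kappa> where "\<kappa> = 2 * C * card I + 1"
  have \<kappa>: "\<kappa> > 0" "card I * C / \<kappa> \<le> 1 / 2"
  proof -
    have *: "0 \<le> C * card I" using \<open>0 \<le> C\<close> by simp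
    then show "\<kappa> > 0" by (simp add: \<kappa>_def)
    with * show "card I * C / \<kappa> \<le> 1 / 2"
      by (simp add: pos_divide_le_eq \<kappa>_def mult.commute)
  qed
  have \<phi>0: "\<phi> y \<ge> 0" for y by (simp add: \<phi>_def sum_nonneg)
  have "continuous_on {a..b} (\<lambda>y. exp (- \<kappa> * (y - a)) * \<phi> y)"
    unfolding \<phi>_def
    by (intro continuous_intros absolutely_continuous_on_imp_continuous_on AC)
  then obtain t where t: "t \<in> {a..b}"
    and tmax: "\<And>y. y \<in> {a..b} \<Longrightarrow> exp (- \<kappa> * (y - a)) * \<phi> y \<le> exp (- \<kappa> * (t - a)) * \<phi> t"
    using continuous_attains_sup[of "{a..b}"] \<open>a \<le> b\<close> by force
  define S where "S = exp (- \<kappa> * (t - a)) * \<phi> t"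
  have "S \<ge> 0" using \<phi>0 by (simp add: S_def)
  have \<phi>_le: "\<phi> y \<le> S * exp (\<kappa> * (y - a))" if "y \<in> {a..b}" for y
  proof -
    have "\<phi> y = exp (\<kappa> * (y - a)) * (exp (- \<kappa> * (y - a)) * \<phi> y)"
      by (simp add: exp_minus)
    also have "\<dots> \<le> exp (\<kappa> * (y - a)) * S"
      unfolding S_def by (intro mult_left_mono tmax that) simp
    finally show ?thesis by (simp add: mult.commute)
  qed
  have \<phi>_t: "\<phi> t = S * exp (\<kappa> * (t - a))"
    by (simp add: S_def exp_minus)
  have "AE y in lebesgue. y \<in> {a<..<b} \<longrightarrow> (\<forall>J\<in>I. Z J differentiable (at y) \<and>
      norm (vector_derivative (Z J) (at y)) \<le> C * \<phi> y)"
    using der by (subst (asm) AE_restrict_space_iff) (auto simp: \<phi>_def)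
  then obtain N where N: "negligible N" and good: "\<And>y J. y \<in> {a<..<b} - N \<Longrightarrow> J \<in> I \<Longrightarrow>
      Z J differentiable (at y) \<and> norm (vector_derivative (Z J) (at y)) \<le> C * \<phi> y"
    unfolding eventually_ae_filter_negligible by blast
  have E: "negligible (N \<union> {a, b})" using N by simp
  \<comment> \<open>A primitive of C S exp (\<kappa> (y - a)), which by \<open>\<phi>_le\<close>
    dominates the derivatives of all \<open>Z J\<close>. Integrating the exponential produces the
    divisor \<kappa>, the source of the factor 1/2.\<close>
  define g where "g y = C * S / \<kappa> * exp (\<kappa> * (y - a))" for y
  have bound: "norm (Z J t) \<le> g t" if J: "J \<in> I" for J
  proof -
    have "norm (Z J t - Z J a) \<le> g t - g a"
    proof (rule absolutely_continuous_mean_value_bound[OF _ _ E])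
      show "a \<le> t" using t by simp
      show "absolutely_continuous_on a t (Z J)"
        using absolutely_continuous_on_subinterval[OF AC[OF J]] t by simp
      fix x assume "x \<in> {a..t} - (N \<union> {a, b})"
      then have x: "x \<in> {a<..<b} - N" using t by auto
      show "(Z J has_vector_derivative vector_derivative (Z J) (at x)) (at x within {a..t})"
        using good[OF x J] by (simp add: vector_derivative_works has_vector_derivative_at_within)
      show "(g has_vector_derivative C * (S * exp (\<kappa> * (x - a)))) (at x within {a..t})"
        unfolding g_def has_real_derivative_iff_has_vector_derivative[symmetric]
        using \<kappa>(1) by (auto intro!: derivative_eq_intros)
      show "norm (vector_derivative (Z J) (at x)) \<le> C * (S * exp (\<kappa> * (x - a)))"
        using good[OF x J] mult_left_mono[OF \<phi>_le[of x] \<open>0 \<le> C\<close>] x by auto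
    next
      show "mono_on {a..t} g"
        using \<kappa>(1) \<open>0 \<le> C\<close> \<open>S \<ge> 0\<close>
        by (intro mono_onI) (simp add: g_def mult_left_mono divide_right_mono)
    qed
    moreover have "g a \<ge> 0" using \<kappa>(1) \<open>0 \<le> C\<close> \<open>S \<ge> 0\<close> by (simp add: g_def)
    ultimately show ?thesis using init[OF J] by simp
  qed
  have "S * exp (\<kappa> * (t - a)) \<le> (\<Sum>J\<in>I. g t)"
    unfolding \<phi>_t[symmetric] \<phi>_def using bound by (rule sum_mono)
  also have "\<dots> = (card I * C / \<kappa> * S) * exp (\<kappa> * (t - a))"
    by (simp add: g_def)
  finally have "S \<le> card I * C / \<kappa> * S" by (rule mult_right_le_imp_le) simp
  also have "\<dots> \<le> 1 / 2 * S"
    using \<kappa>(2) \<open>S \<ge> 0\<close> by (rule mult_right_mono)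
  finally have "S = 0" using \<open>S \<ge> 0\<close> by simp
  then have "\<phi> y = 0" using \<phi>_le[OF \<open>y \<in> {a..b}\<close>] \<phi>0[of y] by simp
  then show ?thesis
    using \<open>finite I\<close> \<open>J \<in> I\<close> by (simp add: \<phi>_def sum_nonneg_eq_0_iff)
qed

subsection \<open>The basis functions\<close>

text \<open>Gram-Schmidt only forms linear combinations, so it does not leave the space of
  polynomials times exp. Smoothness of the basis follows from this form.\<close>

lemma Psi_poly_exp: "\<exists>p. Psi d r = (\<lambda>\<alpha>. poly p \<alpha> * exp \<alpha>)"
proof (induction r rule: less_induct)
  case (less r)
  define f :: "nat \<Rightarrow> real \<Rightarrow> real" where "f = (\<lambda>r \<alpha>. \<alpha> ^ r * exp \<alpha>)"
  have \<Psi>: "Psi d = L2_gram_schmidt d f" by (simp add: Psi_def f_def)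
  from less obtain q where q: "\<And>j. j < r \<Longrightarrow> Psi d j = (\<lambda>\<alpha>. poly (q j) \<alpha> * exp \<alpha>)"
    by metis
  obtain c where c: "Psi d r = (\<lambda>\<alpha>. (f r \<alpha> - (\<Sum>j<r. L2_inner d (f r) (Psi d j) * Psi d j \<alpha>)) / c)"
    using L2_gram_schmidt.simps[of d f r] unfolding \<Psi> Let_def by blast
  have "Psi d r \<alpha> = poly (smult (1 / c)
      (monom 1 r - (\<Sum>j<r. smult (L2_inner d (f r) (Psi d j)) (q j)))) \<alpha> * exp \<alpha>" for \<alpha>
    by (simp add: c f_def q poly_monom poly_sum sum_distrib_right left_diff_distrib diff_divide_distrib
        sum_distrib_left divide_inverse algebra_simps)
  then show ?case by blast
qed

definition Psi' :: "real \<Rightarrow> nat \<Rightarrow> real \<Rightarrow> real" where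
  "Psi' d r = deriv (Psi d r)"

lemma Psi_has_derivative: "(Psi d r has_real_derivative Psi' d r \<alpha>) (at \<alpha> within T)"
  and continuous_on_Psi: "continuous_on S (Psi d r)"
  and continuous_on_Psi': "continuous_on S (Psi' d r)"
proof -
  obtain p where p: "Psi d r = (\<lambda>\<alpha>. poly p \<alpha> * exp \<alpha>)" using Psi_poly_exp by blast
  have D: "(Psi d r has_real_derivative poly (pderiv p) x * exp x + poly p x * exp x) (at x)" for x
    unfolding p by (auto intro!: derivative_eq_intros)
  then have *: "Psi' d r = (\<lambda>x. poly (pderiv p) x * exp x + poly p x * exp x)"
    by (auto simp: Psi'_def DERIV_imp_deriv)
  show "(Psi d r has_real_derivative Psi' d r \<alpha>) (at \<alpha> within T)"
    using D[of \<alpha>] * by (auto intro: has_field_derivative_at_within)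
  show "continuous_on S (Psi d r)" unfolding p by (intro continuous_intros)
  show "continuous_on S (Psi' d r)" unfolding * by (intro continuous_intros)
qed

lemmas continuous_on_Psi_comp [continuous_intros] =
  continuous_on_compose2[OF continuous_on_Psi[of UNIV] _ subset_UNIV]
  continuous_on_compose2[OF continuous_on_Psi'[of UNIV] _ subset_UNIV]

subsection \<open>The matrices of the first-order terms\<close>

lemma source_eq_scaleR: "source i1 \<alpha> = \<alpha> *\<^sub>R source i1 1"
  by (simp add: source_def axis_def vec_eq_iff)

lemma continuous_on_source [continuous_intros]:
  assumes "continuous_on S g"
  shows "continuous_on S (\<lambda>x. source i1 (g x))"
  by (subst source_eq_scaleR) (intro continuous_on_scaleR continuous_on_const assms)

text \<open>All sources lie in the hyperplane y = 0, so a point is at least as far from each of them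
  as from that hyperplane.\<close>

lemma norm_minus_source_ge: "\<bar>snd x\<bar> \<le> norm (x - source i1 \<alpha>)"
  using norm_snd_le[of "snd x" "fst x - axis i1 \<alpha>"] by (simp add: source_def minus_prod_def)

lemma minus_source_nonzero: "0 < snd x \<Longrightarrow> x - source i1 \<alpha> \<noteq> 0"
  using norm_minus_source_ge[of x i1 \<alpha>] by auto

lemma snd_nu: "snd (nu i1 x \<alpha>) = snd x / norm (x - source i1 \<alpha>)"
  by (simp add: nu_def source_def)

text \<open>The \<alpha>-derivative of u / |u| for u = x - source, by the quotient rule; u itself
  has the constant derivative \<open>- source i1 1\<close>.\<close>

definition nu' :: "'n \<Rightarrow> 'n pnt \<Rightarrow> real \<Rightarrow> ('n::finite) pnt" where
  "nu' i1 x \<alpha> = ((x - source i1 \<alpha>) \<bullet> source i1 1 / norm (x - source i1 \<alpha>) ^ 3) *\<^sub>R (x - source i1 \<alpha>)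
     - (1 / norm (x - source i1 \<alpha>)) *\<^sub>R source i1 1"

lemma nu_has_vector_derivative:
  assumes "0 < snd x"
  shows "((\<lambda>\<alpha>. nu i1 x \<alpha>) has_vector_derivative nu' i1 x \<alpha>) (at \<alpha>)"
proof -
  let ?u = "\<lambda>\<alpha>. x - source i1 \<alpha>" and ?e = "source i1 1"
  have nz: "?u \<alpha> \<noteq> 0" by (rule minus_source_nonzero[OF assms])
  have u: "(?u has_vector_derivative - ?e) (at \<alpha>)"
    by (subst source_eq_scaleR) (auto intro!: derivative_eq_intros)
  have "((\<lambda>\<alpha>. norm (?u \<alpha>)) has_derivative (\<lambda>h. (h *\<^sub>R - ?e) \<bullet> sgn (?u \<alpha>))) (at \<alpha>)"
    using has_derivative_compose[OF u[unfolded has_vector_derivative_def] has_derivative_norm[OF nz]]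
    by simp
  then have n: "((\<lambda>\<alpha>. norm (?u \<alpha>)) has_real_derivative - (?e \<bullet> sgn (?u \<alpha>))) (at \<alpha>)"
    by (auto simp: has_field_derivative_def elim!: has_derivative_eq_rhs)
  have i: "((\<lambda>\<alpha>. 1 / norm (?u \<alpha>)) has_real_derivative (?e \<bullet> sgn (?u \<alpha>)) / (norm (?u \<alpha>))\<^sup>2) (at \<alpha>)"
    using nz by (auto intro!: derivative_eq_intros n simp: power2_eq_square)
  have "((\<lambda>\<alpha>. (1 / norm (?u \<alpha>)) *\<^sub>R ?u \<alpha>) has_vector_derivative
     (1 / norm (?u \<alpha>)) *\<^sub>R (- ?e) + ((?e \<bullet> sgn (?u \<alpha>)) / (norm (?u \<alpha>))\<^sup>2) *\<^sub>R ?u \<alpha>) (at \<alpha>)"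
    using i u by (rule has_vector_derivative_scaleR)
  moreover have "(1 / norm (?u \<alpha>)) *\<^sub>R (- ?e) + ((?e \<bullet> sgn (?u \<alpha>)) / (norm (?u \<alpha>))\<^sup>2) *\<^sub>R ?u \<alpha> = nu' i1 x \<alpha>"
    by (simp add: nu'_def sgn_div_norm inner_commute power3_eq_cube power2_eq_square divide_inverse
        mult.commute)
  ultimately show ?thesis by (simp add: nu_def)
qed

lemma deriv_fst_nu:
  assumes "0 < snd x"
  shows "deriv (\<lambda>\<alpha>. fst (nu i1 x \<alpha>) $ i) \<alpha> = fst (nu' i1 x \<alpha>) $ i"
proof -
  have "bounded_linear (\<lambda>z. fst z $ i :: real)"
    by (intro bounded_linear_compose[OF bounded_linear_vec_nth] bounded_linear_fst)
  from bounded_linear.has_vector_derivative[OF this nu_has_vector_derivative[OF assms]]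
  show ?thesis
    by (simp add: DERIV_imp_deriv has_real_derivative_iff_has_vector_derivative)
qed

lemma continuous_on_nu:
  assumes "continuous_on S f" "continuous_on S g" "\<And>z. z \<in> S \<Longrightarrow> 0 < snd (f z)"
  shows "continuous_on S (\<lambda>z. nu i1 (f z) (g z))" "continuous_on S (\<lambda>z. nu' i1 (f z) (g z))"
proof -
  define u where "u z = f z - source i1 (g z)" for z
  have u: "continuous_on S u"
    unfolding u_def by (intro continuous_on_diff continuous_on_source assms)
  have nz: "\<forall>z\<in>S. norm (u z) \<noteq> 0" "\<forall>z\<in>S. norm (u z) ^ 3 \<noteq> 0"
    using minus_source_nonzero[OF assms(3)] by (simp_all add: u_def)
  show "continuous_on S (\<lambda>z. nu i1 (f z) (g z))" "continuous_on S (\<lambda>z. nu' i1 (f z) (g z))"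
    unfolding nu_def nu'_def u_def[symmetric] by (intro continuous_intros u nz)+
qed

lemma snd_nu_pos: "0 < snd x \<Longrightarrow> 0 < snd (nu i1 x \<alpha>)"
  using minus_source_nonzero[of x i1 \<alpha>] by (simp add: snd_nu)

text \<open>Once \<open>deriv\<close> is replaced by the explicit \<open>nu'\<close>, the entries
  are integrals of jointly continuous functions of (x, \<alpha>). On a compact set this bounds the
  matrices of the difference terms.\<close>

lemma continuous_on_A_mat:
  assumes "\<And>x. x \<in> S \<Longrightarrow> 0 < snd x"
  shows "continuous_on S (A_mat idx i1 d i)"
proof -
  have *: "continuous_on S (\<lambda>x. integral (cbox (-d) d) (\<lambda>\<alpha>.
     (fst (nu i1 x \<alpha>) $ i / snd (nu i1 x \<alpha>) * Psi' d (idx r) \<alpha>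
      + fst (nu' i1 x \<alpha>) $ i / snd (nu i1 x \<alpha>) * Psi d (idx r) \<alpha>) * Psi d (idx k) \<alpha>))" for r k
  proof (rule integral_continuous_on_param)
    let ?U = "S \<times> cbox (-d) d"
    have pos: "0 < snd (fst p)" if "p \<in> ?U" for p
      using assms that by auto
    have nz: "snd (nu i1 (fst p) (snd p)) \<noteq> 0" if "p \<in> ?U" for p
      using snd_nu_pos[OF pos[OF that], of i1 "snd p"] by simp
    have \<nu>: "continuous_on ?U (\<lambda>p. nu i1 (fst p) (snd p))" "continuous_on ?U (\<lambda>p. nu' i1 (fst p) (snd p))"
      by (rule continuous_on_nu[OF continuous_on_fst[OF continuous_on_id]
            continuous_on_snd[OF continuous_on_id] pos], assumption)+
    show "continuous_on ?U (\<lambda>(x, \<alpha>). (fst (nu i1 x \<alpha>) $ i / snd (nu i1 x \<alpha>) * Psi' d (idx r) \<alpha>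
      + fst (nu' i1 x \<alpha>) $ i / snd (nu i1 x \<alpha>) * Psi d (idx r) \<alpha>) * Psi d (idx k) \<alpha>)"
      unfolding split_beta
      by (intro continuous_on_mult continuous_on_add continuous_on_divide continuous_on_component
          continuous_on_fst continuous_on_snd \<nu> ballI nz continuous_on_Psi_comp continuous_on_id)
  qed
  have "A_mat idx i1 d i x = (\<chi> k r. integral (cbox (-d) d) (\<lambda>\<alpha>.
     (fst (nu i1 x \<alpha>) $ i / snd (nu i1 x \<alpha>) * Psi' d (idx r) \<alpha>
      + fst (nu' i1 x \<alpha>) $ i / snd (nu i1 x \<alpha>) * Psi d (idx r) \<alpha>) * Psi d (idx k) \<alpha>))"
    if "x \<in> S" for x
    using assms[OF that] by (simp add: A_mat_def deriv_fst_nu Psi'_def)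
  moreover have "continuous_on S (\<lambda>x. \<chi> k r. integral (cbox (-d) d) (\<lambda>\<alpha>.
     (fst (nu i1 x \<alpha>) $ i / snd (nu i1 x \<alpha>) * Psi' d (idx r) \<alpha>
      + fst (nu' i1 x \<alpha>) $ i / snd (nu i1 x \<alpha>) * Psi d (idx r) \<alpha>) * Psi d (idx k) \<alpha>))"
    by (intro continuous_on_vec_lambda *)
  ultimately show ?thesis
    by (simp add: continuous_on_eq)
qed

text \<open>Cauchy-Schwarz in each row, then the sum over the rows; the factor
  \<open>CARD('n)\<close> is crude but depends only on the dimension.\<close>

lemma norm_matrix_vector_mult_le:
  fixes M :: "real^'m^'n" and z :: "real^'m"
  shows "norm (M *v z) \<le> real CARD('n) * norm M * norm z"
proof -
  have "norm (M *v z) \<le> (\<Sum>k\<in>UNIV. \<bar>(M *v z) $ k\<bar>)" by (rule norm_le_l1_cart)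
  also have "\<dots> \<le> (\<Sum>k\<in>(UNIV :: 'n set). norm M * norm z)"
  proof (rule sum_mono)
    fix k
    have "\<bar>(M *v z) $ k\<bar> = \<bar>M $ k \<bullet> z\<bar>"
      by (simp add: matrix_vector_mul_component)
    also have "\<dots> \<le> norm (M $ k) * norm z" by (rule Cauchy_Schwarz_ineq2)
    also have "\<dots> \<le> norm M * norm z"
      by (intro mult_right_mono Finite_Cartesian_Product.norm_nth_le norm_ge_zero)
    finally show "\<bar>(M *v z) $ k\<bar> \<le> norm M * norm z" .
  qed
  finally show ?thesis by simp
qed

subsection \<open>Lipschitz continuity of the nonlinearity\<close>

definition expansion' :: "('N \<Rightarrow> nat) \<Rightarrow> real \<Rightarrow> real^('N::finite) \<Rightarrow> real \<Rightarrow> real" where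
  "expansion' idx d W \<alpha> = (\<Sum>r\<in>UNIV. W $ r * Psi' d (idx r) \<alpha>)"

lemma expansion_has_derivative:
  "(expansion idx d W has_real_derivative expansion' idx d W \<alpha>) (at \<alpha> within T)"
  unfolding expansion_def expansion'_def by (intro DERIV_sum DERIV_cmult Psi_has_derivative)

lemma continuous_on_expansion: "continuous_on S (expansion idx d W)"
  and continuous_on_expansion': "continuous_on S (expansion' idx d W)"
  unfolding expansion_def expansion'_def by (intro continuous_intros)+

lemmas continuous_on_expansion_comp =
  continuous_on_compose2[OF continuous_on_expansion[of UNIV] _ subset_UNIV]
  continuous_on_compose2[OF continuous_on_expansion'[of UNIV] _ subset_UNIV]

lemma expansion_diff:
  "expansion idx d (V - W) \<alpha> = expansion idx d V \<alpha> - expansion idx d W \<alpha>"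
  "expansion' idx d (V - W) \<alpha> = expansion' idx d V \<alpha> - expansion' idx d W \<alpha>"
  by (simp_all add: expansion_def expansion'_def left_diff_distrib sum_subtractf)

text \<open>Both sums are linear in W with coefficients continuous on a compact interval. The
  function \<open>\<Phi>\<close> dominates the coefficients of both, so one constant serves for
  both.\<close>

lemma expansion_bounded:
  fixes idx :: "'N::finite \<Rightarrow> nat"
  shows "\<exists>c\<ge>0. \<forall>\<alpha>\<in>{-d..d}. \<forall>W. \<bar>expansion idx d W \<alpha>\<bar> \<le> c * norm W \<and>
    \<bar>expansion' idx d W \<alpha>\<bar> \<le> c * norm W"
proof -
  define \<Phi> where "\<Phi> \<alpha> = (\<Sum>r\<in>UNIV. \<bar>Psi d (idx r) \<alpha>\<bar> + \<bar>Psi' d (idx r) \<alpha>\<bar>)" for \<alpha>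
  have "continuous_on {-d..d} \<Phi>"
    unfolding \<Phi>_def by (intro continuous_intros continuous_on_Psi continuous_on_Psi')
  then have "bounded (\<Phi> ` {-d..d})"
    by (intro compact_imp_bounded compact_continuous_image compact_Icc)
  then obtain c where c: "c > 0" "\<And>\<alpha>. \<alpha> \<in> {-d..d} \<Longrightarrow> \<bar>\<Phi> \<alpha>\<bar> \<le> c"
    unfolding bounded_pos by auto
  have *: "\<bar>\<Sum>r\<in>UNIV. W $ r * f r\<bar> \<le> c * norm W"
    if "\<alpha> \<in> {-d..d}" "\<And>r. \<bar>f r\<bar> \<le> \<bar>Psi d (idx r) \<alpha>\<bar> + \<bar>Psi' d (idx r) \<alpha>\<bar>"
    for W :: "real^'N" and \<alpha> f
  proof -
    have "\<bar>\<Sum>r\<in>UNIV. W $ r * f r\<bar> \<le> (\<Sum>r\<in>UNIV. norm W * (\<bar>Psi d (idx r) \<alpha>\<bar> + \<bar>Psi' d (idx r) \<alpha>\<bar>))"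
      by (rule order_trans[OF sum_abs], rule sum_mono)
         (auto simp: abs_mult intro!: mult_mono component_le_norm_cart that)
    also have "\<dots> = norm W * \<Phi> \<alpha>" by (simp add: \<Phi>_def sum_distrib_left)
    also have "\<dots> \<le> norm W * c" using c(2)[OF that(1)] by (intro mult_left_mono) auto
    finally show ?thesis by (simp add: mult.commute)
  qed
  show ?thesis
    by (intro exI[of _ c] conjI ballI allI) (use c(1) in \<open>simp_all add: expansion_def expansion'_def *\<close>)
qed

text \<open>From the tangent inequality 1 + (v - u) \<le> exp (v - u), multiplied by exp u.\<close>

lemma exp_diff_abs_le:
  fixes s t M :: real
  assumes "s \<le> M" "t \<le> M"
  shows "\<bar>exp s - exp t\<bar> \<le> exp M * \<bar>s - t\<bar>"
proof -
  have *: "exp u - exp v \<le> exp M * (u - v)" if "v \<le> u" "u \<le> M" for u v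
  proof -
    have "exp u * (1 + (v - u)) \<le> exp u * exp (v - u)"
      by (intro mult_left_mono exp_ge_add_one_self) simp
    then have "exp u - exp v \<le> exp u * (u - v)"
      by (simp add: mult_exp_exp algebra_simps)
    also have "\<dots> \<le> exp M * (u - v)" using that by (intro mult_right_mono) auto
    finally show ?thesis .
  qed
  show ?thesis
  proof (cases "t \<le> s")
    case True
    then show ?thesis using *[of t s] assms by auto
  next
    case False
    then have "exp s < exp t" by simp
    then show ?thesis using *[of s t] False assms by auto
  qed
qed

section \<open>The kernel of F: its \<alpha>-derivative, Lipschitz bounds and differentiation under
  the integral\<close>

lemma C2_on_imp_continuous_on:
  assumes "C2_on S f"
  shows "continuous_on S f"
proof -
  from assms obtain f' where "\<And>x. x \<in> S \<Longrightarrow> (f has_derivative blinfun_apply (f' x)) (at x within S)"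
    unfolding C2_on_def by blast
  then show ?thesis by (rule has_derivative_continuous_on)
qed

text \<open>The partial derivative is the total derivative applied to the direction (0, 1, 0); it is
  continuous because the total derivative is itself differentiable. At the end points of an interval
  \<open>I\<close> it is one-sided.\<close>

lemma C2_on_middle_derivative:
  assumes "C2_on (S \<times> I \<times> J) K"
  obtains K' where "continuous_on (S \<times> I \<times> J) K'"
    and "\<And>x \<alpha> \<beta>. x \<in> S \<Longrightarrow> \<alpha> \<in> I \<Longrightarrow> \<beta> \<in> J \<Longrightarrow>
      ((\<lambda>\<alpha>. K (x, \<alpha>, \<beta>)) has_real_derivative K' (x, \<alpha>, \<beta>)) (at \<alpha> within I)"
proof -
  from assms obtain f' f'' where
    f': "\<And>p. p \<in> S \<times> I \<times> J \<Longrightarrow> (K has_derivative blinfun_apply (f' p)) (at p within S \<times> I \<times> J)"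
    and f'': "\<And>p. p \<in> S \<times> I \<times> J \<Longrightarrow> (f' has_derivative blinfun_apply (f'' p)) (at p within S \<times> I \<times> J)"
    unfolding C2_on_def by blast
  show thesis
  proof (rule that[of "\<lambda>p. blinfun_apply (f' p) (0, 1, 0)"])
    have "continuous_on (S \<times> I \<times> J) f'"
      using f'' by (rule has_derivative_continuous_on)
    then show "continuous_on (S \<times> I \<times> J) (\<lambda>p. blinfun_apply (f' p) (0, 1, 0))"
      by (intro continuous_intros)
    fix x \<alpha> \<beta> assume *: "x \<in> S" "\<alpha> \<in> I" "\<beta> \<in> J"
    have g: "((\<lambda>\<alpha>. (x, \<alpha>, \<beta>)) has_derivative (\<lambda>h. (0, h, 0))) (at \<alpha> within I)"
      by (auto intro!: derivative_eq_intros)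
    have "((\<lambda>\<alpha>. K (x, \<alpha>, \<beta>)) has_derivative (\<lambda>h. f' (x, \<alpha>, \<beta>) (0, h, 0))) (at \<alpha> within I)"
      using * by (intro has_derivative_in_compose2[OF f' _ _ g]) auto
    moreover have "(\<lambda>h. f' (x, \<alpha>, \<beta>) (0, h, 0)) = (*) (f' (x, \<alpha>, \<beta>) (0, 1, 0))"
    proof
      fix h
      show "f' (x, \<alpha>, \<beta>) (0, h, 0) = f' (x, \<alpha>, \<beta>) (0, 1, 0) * h"
        using blinfun.scaleR_right[of "f' (x, \<alpha>, \<beta>)" h "(0, 1, 0)"] by simp
    qed
    ultimately show "((\<lambda>\<alpha>. K (x, \<alpha>, \<beta>)) has_real_derivative f' (x, \<alpha>, \<beta>) (0, 1, 0)) (at \<alpha> within I)"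
      by (simp only: has_field_derivative_def)
  qed
qed

text \<open>The \<alpha>-derivative of K (x, \<alpha>, \<beta>) exp (w \<beta> - w \<alpha>) when K'
  is the \<alpha>-derivative of K: the integrand of F after the factor exp (- w \<alpha>) has been
  moved under the integral in \<beta>.\<close>

definition F_kernel ::
  "('N::finite \<Rightarrow> nat) \<Rightarrow> real \<Rightarrow> ('a \<times> real \<times> real \<Rightarrow> real) \<Rightarrow> ('a \<times> real \<times> real \<Rightarrow> real)
    \<Rightarrow> real^'N \<Rightarrow> 'a \<Rightarrow> real \<Rightarrow> real \<Rightarrow> real" where
  "F_kernel idx d K K' W x \<alpha> \<beta> = (K' (x, \<alpha>, \<beta>) - expansion' idx d W \<alpha> * K (x, \<alpha>, \<beta>))
     * exp (expansion idx d W \<beta> - expansion idx d W \<alpha>)"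

lemma continuous_on_F_kernel:
  assumes "continuous_on (S \<times> I \<times> J) K" "continuous_on (S \<times> I \<times> J) K'" "x \<in> S"
  shows "continuous_on (I \<times> J) (\<lambda>(\<alpha>, \<beta>). F_kernel idx d K K' W x \<alpha> \<beta>)"
proof -
  have "continuous_on (I \<times> J) (\<lambda>p. K (x, fst p, snd p))" "continuous_on (I \<times> J) (\<lambda>p. K' (x, fst p, snd p))"
    using assms(3)
    by (auto intro!: continuous_on_compose2[OF assms(1)] continuous_on_compose2[OF assms(2)] continuous_intros)
  then show ?thesis
    unfolding F_kernel_def split_beta
    by (intro continuous_on_mult continuous_on_diff continuous_on_exp continuous_on_expansion_comp
        continuous_on_fst continuous_on_snd continuous_on_id)
qed

text \<open>The kernel is q exp s with q affine and s linear in W. Only the exponential forces the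
  restriction to a ball of radius \<open>R\<close>.\<close>

lemma F_kernel_Lipschitz:
  fixes idx :: "'N::finite \<Rightarrow> nat" and K K' :: "'a::topological_space \<times> real \<times> real \<Rightarrow> real"
  assumes S: "compact S" and K: "continuous_on (S \<times> {-d..d} \<times> {-d..d}) K"
    and K': "continuous_on (S \<times> {-d..d} \<times> {-d..d}) K'"
  shows "\<exists>L\<ge>0. \<forall>V W x \<alpha> \<beta>. norm V \<le> R \<longrightarrow> norm W \<le> R \<longrightarrow> x \<in> S \<longrightarrow> \<alpha> \<in> {-d..d} \<longrightarrow> \<beta> \<in> {-d..d} \<longrightarrow>
      \<bar>F_kernel idx d K K' V x \<alpha> \<beta> - F_kernel idx d K K' W x \<alpha> \<beta>\<bar> \<le> L * norm (V - W)"
proof -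
  obtain c where c: "c \<ge> 0"
    "\<And>W \<alpha>. \<alpha> \<in> {-d..d} \<Longrightarrow> \<bar>expansion idx d W \<alpha>\<bar> \<le> c * norm W"
    "\<And>W \<alpha>. \<alpha> \<in> {-d..d} \<Longrightarrow> \<bar>expansion' idx d W \<alpha>\<bar> \<le> c * norm W"
    using expansion_bounded[of d idx] by blast
  have "compact (S \<times> {-d..d} \<times> {-d..d})" by (intro compact_Times S compact_Icc)
  then have "bounded (K ` (S \<times> {-d..d} \<times> {-d..d}))" "bounded (K' ` (S \<times> {-d..d} \<times> {-d..d}))"
    using K K' by (auto intro!: compact_imp_bounded compact_continuous_image)
  then obtain B1 B2 where B: "B1 > 0" "\<And>p. p \<in> S \<times> {-d..d} \<times> {-d..d} \<Longrightarrow> \<bar>K p\<bar> \<le> B1"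
    "B2 > 0" "\<And>p. p \<in> S \<times> {-d..d} \<times> {-d..d} \<Longrightarrow> \<bar>K' p\<bar> \<le> B2"
    unfolding bounded_pos by fastforce
  \<comment> \<open>Bounds the exponent s, a difference of two expansions of size at most c |R|
    each. The absolute value keeps the constants nonnegative for every real
    \<open>R\<close>.\<close>
  define M where "M = 2 * c * \<bar>R\<bar>"
  define L where "L = c * B1 * exp M + (B2 + c * \<bar>R\<bar> * B1) * (exp M * (2 * c))"
  show ?thesis
  proof (intro exI[of _ L] conjI allI impI)
    show "L \<ge> 0" using c B by (simp add: L_def)
    fix V W :: "real^'N" and x \<alpha> \<beta>
    assume R: "norm V \<le> R" "norm W \<le> R" and x: "x \<in> S" "\<alpha> \<in> {-d..d}" "\<beta> \<in> {-d..d}"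
    define s where "s U = expansion idx d U \<beta> - expansion idx d U \<alpha>" for U
    define q where "q U = K' (x, \<alpha>, \<beta>) - expansion' idx d U \<alpha> * K (x, \<alpha>, \<beta>)" for U
    have KB: "\<bar>K (x, \<alpha>, \<beta>)\<bar> \<le> B1" "\<bar>K' (x, \<alpha>, \<beta>)\<bar> \<le> B2" using B x by auto
    have cR: "c * norm U \<le> c * \<bar>R\<bar>" if "norm U \<le> R" for U :: "real^'N"
      using that c(1) by (intro mult_left_mono) auto
    have sM: "s U \<le> M" if "norm U \<le> R" for U
      using c(2)[OF x(2), of U] c(2)[OF x(3), of U] cR[OF that] by (auto simp: s_def M_def)
    have sd: "\<bar>s V - s W\<bar> \<le> 2 * c * norm (V - W)"
    proof -
      have "s V - s W = expansion idx d (V - W) \<beta> - expansion idx d (V - W) \<alpha>"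
        by (simp add: s_def expansion_diff)
      then show ?thesis using c(2)[OF x(2), of "V - W"] c(2)[OF x(3), of "V - W"] by auto
    qed
    have qd: "\<bar>q V - q W\<bar> \<le> c * norm (V - W) * B1"
    proof -
      have "q V - q W = - (expansion' idx d (V - W) \<alpha> * K (x, \<alpha>, \<beta>))"
        by (simp add: q_def expansion_diff algebra_simps)
      then show ?thesis
        using mult_mono[OF c(3)[OF x(2), of "V - W"] KB(1)] c(1) by (simp add: abs_mult)
    qed
    have qW: "\<bar>q W\<bar> \<le> B2 + c * \<bar>R\<bar> * B1"
    proof -
      have "\<bar>expansion' idx d W \<alpha> * K (x, \<alpha>, \<beta>)\<bar> \<le> c * \<bar>R\<bar> * B1"
        unfolding abs_mult using c(3)[OF x(2), of W] cR[OF R(2)] c(1) KB(1)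
        by (intro mult_mono) auto
      then show ?thesis using KB(2) unfolding q_def by linarith
    qed
    \<comment> \<open>The product is varied one factor at a time; the two terms correspond to the
      two summands of \<open>L\<close>.\<close>
    have "F_kernel idx d K K' V x \<alpha> \<beta> - F_kernel idx d K K' W x \<alpha> \<beta>
        = (q V - q W) * exp (s V) + q W * (exp (s V) - exp (s W))"
      by (simp add: F_kernel_def q_def s_def algebra_simps)
    also have "\<bar>\<dots>\<bar> \<le> \<bar>q V - q W\<bar> * exp (s V) + \<bar>q W\<bar> * \<bar>exp (s V) - exp (s W)\<bar>"
      by (rule order_trans[OF abs_triangle_ineq]) (simp add: abs_mult)
    also have "\<dots> \<le> (c * norm (V - W) * B1) * exp M
        + (B2 + c * \<bar>R\<bar> * B1) * (exp M * (2 * c * norm (V - W)))"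
    proof (rule add_mono)
      show "\<bar>q V - q W\<bar> * exp (s V) \<le> (c * norm (V - W) * B1) * exp M"
        using qd sM[OF R(1)] c(1) B by (intro mult_mono) auto
      have "\<bar>exp (s V) - exp (s W)\<bar> \<le> exp M * \<bar>s V - s W\<bar>"
        using sM R by (intro exp_diff_abs_le) auto
      also have "\<dots> \<le> exp M * (2 * c * norm (V - W))"
        using sd by (intro mult_left_mono) auto
      finally show "\<bar>q W\<bar> * \<bar>exp (s V) - exp (s W)\<bar> \<le> (B2 + c * \<bar>R\<bar> * B1) * (exp M * (2 * c * norm (V - W)))"
        using qW c(1) B by (intro mult_mono) auto
    qed
    also have "\<dots> = L * norm (V - W)" by (simp add: L_def algebra_simps)
    finally show "\<bar>F_kernel idx d K K' V x \<alpha> \<beta> - F_kernel idx d K K' W x \<alpha> \<beta>\<bar> \<le> L * norm (V - W)" .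
  qed
qed

lemma F_vec_eq:
  fixes idx :: "'N::finite \<Rightarrow> nat"
  assumes "d > 0" and "x \<in> S"
    and K: "continuous_on (S \<times> {-d..d} \<times> {-d..d}) K"
    and K': "continuous_on (S \<times> {-d..d} \<times> {-d..d}) K'"
    and KD: "\<And>x \<alpha> \<beta>. x \<in> S \<Longrightarrow> \<alpha> \<in> {-d..d} \<Longrightarrow> \<beta> \<in> {-d..d} \<Longrightarrow>
      ((\<lambda>\<alpha>. K (x, \<alpha>, \<beta>)) has_real_derivative K' (x, \<alpha>, \<beta>)) (at \<alpha> within {-d..d})"
  shows "F_vec idx i1 d \<mu>s K W x $ k = - integral {-d..d} (\<lambda>\<alpha>. \<mu>s x / snd (nu i1 x \<alpha>)
    * integral {-d..d} (F_kernel idx d K K' W x \<alpha>) * Psi d (idx k) \<alpha>)"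
proof -
  let ?w = "expansion idx d W"
  have *: "vector_derivative
         (\<lambda>\<alpha>. exp (- ?w \<alpha>) * integral {-d..d} (\<lambda>\<beta>. K (x, \<alpha>, \<beta>) * exp (?w \<beta>))) (at \<alpha> within {-d..d})
      = integral {-d..d} (F_kernel idx d K K' W x \<alpha>)" if \<alpha>: "\<alpha> \<in> {-d..d}" for \<alpha>
  proof -
    \<comment> \<open>With exp (- w \<alpha>) inside, only one integrand depends on \<alpha>, and
      the Leibniz rule applies to it directly.\<close>
    have eq: "exp (- ?w \<alpha>) * integral {-d..d} (\<lambda>\<beta>. K (x, \<alpha>, \<beta>) * exp (?w \<beta>))
        = integral (cbox (-d) d) (\<lambda>\<beta>. K (x, \<alpha>, \<beta>) * exp (?w \<beta> - ?w \<alpha>))" for \<alpha>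
    proof -
      have "exp (- ?w \<alpha>) * integral {-d..d} (\<lambda>\<beta>. K (x, \<alpha>, \<beta>) * exp (?w \<beta>))
        = integral {-d..d} (\<lambda>\<beta>. exp (- ?w \<alpha>) * (K (x, \<alpha>, \<beta>) * exp (?w \<beta>)))"
        by (rule integral_mult_right[symmetric])
      then show ?thesis by (simp add: exp_diff exp_minus field_simps)
    qed
    have "((\<lambda>\<alpha>. integral (cbox (-d) d) (\<lambda>\<beta>. K (x, \<alpha>, \<beta>) * exp (?w \<beta> - ?w \<alpha>)))
        has_vector_derivative integral (cbox (-d) d) (F_kernel idx d K K' W x \<alpha>)) (at \<alpha> within {-d..d})"
    proof (rule leibniz_rule_vector_derivative[OF _ _ _ \<alpha>])
      fix \<alpha> \<beta> assume "\<alpha> \<in> {-d..d}" "\<beta> \<in> cbox (-d) d"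
      then have "((\<lambda>\<alpha>. K (x, \<alpha>, \<beta>)) has_real_derivative K' (x, \<alpha>, \<beta>)) (at \<alpha> within {-d..d})"
        using KD \<open>x \<in> S\<close> by simp
      then show "((\<lambda>\<alpha>. K (x, \<alpha>, \<beta>) * exp (?w \<beta> - ?w \<alpha>)) has_vector_derivative
          F_kernel idx d K K' W x \<alpha> \<beta>) (at \<alpha> within {-d..d})"
        unfolding has_real_derivative_iff_has_vector_derivative[symmetric]
        by (auto intro!: derivative_eq_intros expansion_has_derivative simp: F_kernel_def algebra_simps)
    next
      fix \<alpha> assume "\<alpha> \<in> {-d..d}"
      then have "continuous_on {-d..d} (\<lambda>\<beta>. K (x, \<alpha>, \<beta>))"
        using \<open>x \<in> S\<close> by (intro continuous_on_compose2[OF K]) (auto intro!: continuous_intros)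
      then show "(\<lambda>\<beta>. K (x, \<alpha>, \<beta>) * exp (?w \<beta> - ?w \<alpha>)) integrable_on cbox (-d) d"
        unfolding cbox_interval
        by (intro integrable_continuous_real continuous_intros continuous_on_expansion)
    next
      show "continuous_on ({-d..d} \<times> cbox (-d) d) (\<lambda>(\<alpha>, \<beta>). F_kernel idx d K K' W x \<alpha> \<beta>)"
        using continuous_on_F_kernel[OF K K' \<open>x \<in> S\<close>] by simp
    qed simp
    \<comment> \<open>As d > 0, the interval is nondegenerate, and derivatives within it are unique
      even at its end points.\<close>
    then show ?thesis
      unfolding eq using \<open>d > 0\<close> \<alpha>
      by (intro vector_derivative_within_closed_interval) (auto simp: cbox_interval)
  qed
  show ?thesis
    unfolding F_vec_def vec_lambda_beta
    by (intro arg_cong[where f = uminus] integral_cong) (simp only: *)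
qed

lemma F_vec_Lipschitz:
  fixes idx :: "'N::finite \<Rightarrow> nat"
  assumes "d > 0" and S: "compact S" and pos: "\<And>x. x \<in> S \<Longrightarrow> 0 < snd x"
    and K: "C2_on (S \<times> {-d..d} \<times> {-d..d}) K" and \<mu>: "continuous_on S \<mu>s"
  shows "\<exists>L\<ge>0. \<forall>V W x. norm V \<le> R \<longrightarrow> norm W \<le> R \<longrightarrow> x \<in> S \<longrightarrow>
      norm (F_vec idx i1 d \<mu>s K V x - F_vec idx i1 d \<mu>s K W x) \<le> L * norm (V - W)"
proof -
  obtain K' where K': "continuous_on (S \<times> {-d..d} \<times> {-d..d}) K'"
    and KD: "\<And>x \<alpha> \<beta>. x \<in> S \<Longrightarrow> \<alpha> \<in> {-d..d} \<Longrightarrow> \<beta> \<in> {-d..d} \<Longrightarrow>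
      ((\<lambda>\<alpha>. K (x, \<alpha>, \<beta>)) has_real_derivative K' (x, \<alpha>, \<beta>)) (at \<alpha> within {-d..d})"
    using C2_on_middle_derivative[OF K] by blast
  note Kc = C2_on_imp_continuous_on[OF K]
  obtain L where L: "L \<ge> 0"
    and kernel: "\<And>V W x \<alpha> \<beta>. norm V \<le> R \<Longrightarrow> norm W \<le> R \<Longrightarrow> x \<in> S \<Longrightarrow> \<alpha> \<in> {-d..d} \<Longrightarrow> \<beta> \<in> {-d..d} \<Longrightarrow>
      \<bar>F_kernel idx d K K' V x \<alpha> \<beta> - F_kernel idx d K K' W x \<alpha> \<beta>\<bar> \<le> L * norm (V - W)"
    using F_kernel_Lipschitz[OF S Kc K', of R idx] by blast
  \<comment> \<open>Collects the factors of the outer integrand that are free of W. They are bounded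
    by compactness, the last component of \<open>nu\<close> being positive on
    \<open>S\<close>.\<close>
  define \<rho> where "\<rho> k p = \<mu>s (fst p) / snd (nu i1 (fst p) (snd p)) * Psi d (idx k) (snd p)" for k p
  have \<rho>: "continuous_on (S \<times> {-d..d}) (\<rho> k)" for k
  proof -
    have \<nu>: "continuous_on (S \<times> {-d..d}) (\<lambda>p. nu i1 (fst p) (snd p))"
      using pos by (intro continuous_on_nu continuous_intros) auto
    have "continuous_on (S \<times> {-d..d}) (\<lambda>p. \<mu>s (fst p))"
      by (rule continuous_on_compose2[OF \<mu>]) (auto intro!: continuous_intros)
    moreover have "\<forall>p\<in>S \<times> {-d..d}. snd (nu i1 (fst p) (snd p)) \<noteq> 0"
      using snd_nu_pos pos by (metis less_irrefl mem_Times_iff)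
    ultimately show ?thesis
      unfolding \<rho>_def
      by (intro continuous_on_mult continuous_on_divide continuous_on_snd[OF \<nu>]
          continuous_on_Psi_comp continuous_on_snd continuous_on_id)
  qed
  have "bounded (\<Union>k. \<rho> k ` (S \<times> {-d..d}))"
    by (intro bounded_UN finite ballI compact_imp_bounded compact_continuous_image \<rho> compact_Times S compact_Icc)
  then obtain B where B: "B > 0" "\<And>k p. p \<in> S \<times> {-d..d} \<Longrightarrow> \<bar>\<rho> k p\<bar> \<le> B"
    unfolding bounded_pos by fastforce
  \<comment> \<open>Each of the integrations in \<beta> and in \<alpha> contributes the length 2 d
    of the interval.\<close>
  define C where "C = B * (L * (2 * d)) * (2 * d)"
  have comp: "\<bar>F_vec idx i1 d \<mu>s K V x $ k - F_vec idx i1 d \<mu>s K W x $ k\<bar> \<le> C * norm (V - W)"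
    if R: "norm V \<le> R" "norm W \<le> R" and x: "x \<in> S" for V W x k
  proof -
    define g where "g U \<alpha> = integral {-d..d} (F_kernel idx d K K' U x \<alpha>)" for U \<alpha>
    have c2: "continuous_on ({-d..d} \<times> cbox (-d) d) (\<lambda>(\<alpha>, \<beta>). F_kernel idx d K K' U x \<alpha> \<beta>)" for U
      using continuous_on_F_kernel[OF Kc K' x] by simp
    have gc: "continuous_on {-d..d} (g U)" for U
      using integral_continuous_on_param[OF c2] by (simp add: g_def[abs_def])
    have kint: "F_kernel idx d K K' U x \<alpha> integrable_on {-d..d}" if "\<alpha> \<in> {-d..d}" for U \<alpha>
      by (intro integrable_continuous_real continuous_on_compose2[OF c2, of "{-d..d}" "\<lambda>\<beta>. (\<alpha>, \<beta>)", simplified])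
         (use that in \<open>auto intro!: continuous_intros\<close>)
    have gd: "\<bar>g V \<alpha> - g W \<alpha>\<bar> \<le> L * norm (V - W) * (2 * d)" if "\<alpha> \<in> {-d..d}" for \<alpha>
    proof -
      have "g V \<alpha> - g W \<alpha> = integral {-d..d} (\<lambda>\<beta>. F_kernel idx d K K' V x \<alpha> \<beta> - F_kernel idx d K K' W x \<alpha> \<beta>)"
        unfolding g_def by (rule integral_diff[symmetric]; rule kint[OF that])
      also have "norm \<dots> \<le> integral {-d..d} (\<lambda>\<beta>. L * norm (V - W))"
      proof (intro integral_norm_bound_integral integrable_diff kint that)
        fix \<beta> assume "\<beta> \<in> {-d..d}"
        then show "norm (F_kernel idx d K K' V x \<alpha> \<beta> - F_kernel idx d K K' W x \<alpha> \<beta>) \<le> L * norm (V - W)"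
          unfolding real_norm_def by (rule kernel[OF R x that])
      qed (rule integrable_const_ivl)
      finally show ?thesis using \<open>d > 0\<close> by (simp add: mult_ac)
    qed
    have \<rho>c: "continuous_on {-d..d} (\<lambda>\<alpha>. \<rho> k (x, \<alpha>))"
      by (rule continuous_on_compose2[OF \<rho>, where f = "Pair x"])
         (use x in \<open>auto intro!: continuous_on_Pair\<close>)
    have int: "(\<lambda>\<alpha>. \<rho> k (x, \<alpha>) * g U \<alpha>) integrable_on {-d..d}" for U
      by (intro integrable_continuous_real continuous_on_mult \<rho>c gc)
    have F: "F_vec idx i1 d \<mu>s K U x $ k = - integral {-d..d} (\<lambda>\<alpha>. \<rho> k (x, \<alpha>) * g U \<alpha>)" for U
    proof -
      have "F_vec idx i1 d \<mu>s K U x $ k = - integral {-d..d} (\<lambda>\<alpha>. \<mu>s x / snd (nu i1 x \<alpha>)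
          * integral {-d..d} (F_kernel idx d K K' U x \<alpha>) * Psi d (idx k) \<alpha>)"
        by (rule F_vec_eq[OF \<open>d > 0\<close> x Kc K' KD])
      also have "(\<lambda>\<alpha>. \<mu>s x / snd (nu i1 x \<alpha>) * integral {-d..d} (F_kernel idx d K K' U x \<alpha>) * Psi d (idx k) \<alpha>)
          = (\<lambda>\<alpha>. \<rho> k (x, \<alpha>) * g U \<alpha>)"
        by (simp add: \<rho>_def g_def fun_eq_iff)
      finally show ?thesis .
    qed
    have "F_vec idx i1 d \<mu>s K V x $ k - F_vec idx i1 d \<mu>s K W x $ k
        = - integral {-d..d} (\<lambda>\<alpha>. \<rho> k (x, \<alpha>) * g V \<alpha> - \<rho> k (x, \<alpha>) * g W \<alpha>)"
      unfolding F by (simp add: integral_diff[OF int int])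
    also have "\<bar>\<dots>\<bar> \<le> integral {-d..d} (\<lambda>\<alpha>. B * (L * norm (V - W) * (2 * d)))"
      unfolding real_norm_def[symmetric] norm_minus_cancel
    proof (intro integral_norm_bound_integral integrable_diff int)
      fix \<alpha> assume \<alpha>: "\<alpha> \<in> {-d..d}"
      have "norm (\<rho> k (x, \<alpha>) * g V \<alpha> - \<rho> k (x, \<alpha>) * g W \<alpha>) = \<bar>\<rho> k (x, \<alpha>)\<bar> * \<bar>g V \<alpha> - g W \<alpha>\<bar>"
        by (simp add: abs_mult[symmetric] right_diff_distrib)
      also have "\<dots> \<le> B * (L * norm (V - W) * (2 * d))"
        using B x \<alpha> gd[OF \<alpha>] by (intro mult_mono) auto
      finally show "norm (\<rho> k (x, \<alpha>) * g V \<alpha> - \<rho> k (x, \<alpha>) * g W \<alpha>) \<le> B * (L * norm (V - W) * (2 * d))" .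
    qed (rule integrable_const_ivl)
    also have "\<dots> = C * norm (V - W)" using \<open>d > 0\<close> by (simp add: C_def)
    finally show ?thesis .
  qed
  show ?thesis
  proof (intro exI[of _ "CARD('N) * C"] conjI allI impI)
    show "CARD('N) * C \<ge> 0" using L B \<open>d > 0\<close> by (simp add: C_def)
    fix V W :: "real^'N" and x assume *: "norm V \<le> R" "norm W \<le> R" "x \<in> S"
    have "norm (F_vec idx i1 d \<mu>s K V x - F_vec idx i1 d \<mu>s K W x)
        \<le> (\<Sum>k\<in>UNIV. \<bar>(F_vec idx i1 d \<mu>s K V x - F_vec idx i1 d \<mu>s K W x) $ k\<bar>)"
      by (rule norm_le_l1_cart)
    also have "\<dots> \<le> (\<Sum>k\<in>(UNIV :: 'N set). C * norm (V - W))"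
      by (rule sum_mono) (simp add: comp *)
    finally show "norm (F_vec idx i1 d \<mu>s K V x - F_vec idx i1 d \<mu>s K W x) \<le> CARD('N) * C * norm (V - W)"
      by simp
  qed
qed

subsection \<open>Uniqueness on the grid\<close>

lemma Omega_subset_cbox: "Omega A a b \<subseteq> cbox (\<chi> i. - A, a) (\<chi> i. A, b)"
  by (auto simp: Omega_def cbox_Pair_eq mem_box_cart less_imp_le)

lemma closure_Omega_subset_cbox: "closure (Omega A a b) \<subseteq> cbox (\<chi> i. - A, a) (\<chi> i. A, b)"
  by (rule closure_minimal[OF Omega_subset_cbox closed_cbox])

lemma compact_closure_Omega: "compact (closure (Omega A a b))"
  by (meson bounded_cbox bounded_subset closed_closure closure_Omega_subset_cbox compact_eq_bounded_closed)

lemma snd_ge_of_closure_Omega: "x \<in> closure (Omega A a b) \<Longrightarrow> a \<le> snd x"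
  using closure_Omega_subset_cbox by (fastforce simp: cbox_Pair_eq)

lemma finite_interior_grid: "finite (interior_grid m :: ('n::finite \<Rightarrow> nat) set)"
proof (rule finite_subset)
  show "interior_grid m \<subseteq> (UNIV :: 'n set) \<rightarrow>\<^sub>E {..m}"
    by (auto simp: interior_grid_def intro: order_trans[OF _ diff_le_self])
qed (simp add: finite_PiE)

lemma node_in_Omega:
  assumes "A > 0" "m > 1" "J \<in> interior_grid m" "y \<in> {a<..<b}"
  shows "(node A m J, y) \<in> Omega A a b"
proof -
  have "- A < node A m J $ i \<and> node A m J $ i < A" for i
  proof -
    have "1 \<le> J i" "J i \<le> m - 1" using assms(3) by (auto simp: interior_grid_def)
    then have "0 < real (J i)" "real (J i) < real m" using assms(2) by linarith+
    then have "0 < real (J i) * (2 * A / real m)" "real (J i) * (2 * A / real m) < 2 * A"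
      using assms(1) by (simp_all add: pos_divide_less_eq)
    then show ?thesis by (simp add: node_def step_def)
  qed
  then show ?thesis using assms(4) by (simp add: Omega_def)
qed

text \<open>A centred difference at an interior node thus reads only values at grid nodes, where Z
  is either an interior value or fixed by the boundary condition.\<close>

lemma neighbours_in_grid:
  assumes "J \<in> interior_grid m" "m > 1"
  shows "J(k := J k + 1) \<in> grid m" "J(k := J k - 1) \<in> grid m"
proof -
  have "J i + 1 \<le> m" for i
  proof -
    have "J i \<le> m - 1" using assms(1) by (simp add: interior_grid_def)
    then show ?thesis using assms(2) by linarith
  qed
  moreover from this have "J i \<le> m" "J i - 1 \<le> m" for i
    by (metis add_leD1, metis add_leD1 le_trans diff_le_self)
  ultimately show "J(k := J k + 1) \<in> grid m" "J(k := J k - 1) \<in> grid m"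
    by (simp_all add: grid_def)
qed

lemma interior_grid_subset_grid: "interior_grid m \<subseteq> grid m"
  by (auto simp: interior_grid_def grid_def intro: order_trans[OF _ diff_le_self])

section \<open>Bounds for the linear operators of the system and for its solutions\<close>

lemma norm_le_matrix_inv:
  fixes D :: "real^'n^'n"
  assumes "invertible D"
  shows "norm u \<le> real CARD('n) * norm (matrix_inv D) * norm (D *v u)"
proof -
  \<comment> \<open>\<open>matrix_inv\<close> is defined by a choice; invertibility supplies a
    two-sided inverse, of which the left half is kept.\<close>
  have "matrix_inv D ** D = mat 1"
    using assms unfolding invertible_def matrix_inv_def by (rule someI2_ex) simp
  then have "u = matrix_inv D *v (D *v u)"
    by (simp add: matrix_vector_mul_assoc)
  then show ?thesis by (metis norm_matrix_vector_mult_le)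
qed

lemma diff_x_diff: "diff_x A m k (\<lambda>J y. U J y - V J y) J y = diff_x A m k U J y - diff_x A m k V J y"
  by (simp add: diff_x_def algebra_simps)

text \<open>The bound \<sigma> is asked on the whole grid, since a neighbour of an interior node may
  lie on the boundary. The two neighbours give 2 \<sigma>, divided by twice the step.\<close>

lemma norm_diff_x_le:
  fixes Z :: "('n::finite \<Rightarrow> nat) \<Rightarrow> real \<Rightarrow> 'v::real_normed_vector"
  assumes "J \<in> interior_grid m" "m > 1" "step A m > 0"
    and "\<And>J'. J' \<in> grid m \<Longrightarrow> norm (Z J' y) \<le> \<sigma>"
  shows "norm (diff_x A m k Z J y) \<le> \<sigma> / step A m"
proof -
  have "norm (Z (J(k := J k + 1)) y - Z (J(k := J k - 1)) y) \<le> 2 * \<sigma>"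
    using norm_triangle_ineq4[of "Z (J(k := J k + 1)) y" "Z (J(k := J k - 1)) y"]
      assms(4)[OF neighbours_in_grid(1)[OF assms(1,2), of k]]
      assms(4)[OF neighbours_in_grid(2)[OF assms(1,2), of k]] by linarith
  then have "norm (diff_x A m k Z J y) \<le> inverse (2 * step A m) * (2 * \<sigma>)"
    using assms(3) unfolding diff_x_def norm_scaleR by (intro mult_mono) auto
  then show ?thesis by (simp add: field_simps)
qed

text \<open>Supplies the radius of the ball on which F is Lipschitz: there are finitely many nodes,
  each with a continuous function on a compact interval.\<close>

lemma grid_function_bounded:
  assumes "\<And>J. J \<in> interior_grid m \<Longrightarrow> absolutely_continuous_on a b (Q J)"
  shows "\<exists>R. \<forall>J\<in>interior_grid m. \<forall>y\<in>{a..b}. norm (Q J y) \<le> R"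
proof -
  have "bounded (\<Union>J\<in>interior_grid m. Q J ` {a..b})"
    by (intro bounded_UN finite_interior_grid ballI compact_imp_bounded compact_continuous_image
        absolutely_continuous_on_imp_continuous_on assms compact_Icc)
  then show ?thesis unfolding bounded_iff by blast
qed

lemma solution_diff_zero:
  fixes idx :: "'N::finite \<Rightarrow> nat" and i1 :: "'n::finite"
    and W1 W2 :: "('n \<Rightarrow> nat) \<Rightarrow> real \<Rightarrow> real^'N"
  assumes "A > 0" "d > 0" "1 < a" "a < b" "m > 1"
    and K: "C2_on (closure (Omega A a b) \<times> {-d..d} \<times> {-d..d}) K"
    and \<mu>: "continuous_on UNIV \<mu>s"
    and inv: "\<And>x. x \<in> closure (Omega A a b) \<Longrightarrow> invertible (D_mat idx i1 d x)"
    and bdd: "bounded ((\<lambda>x. matrix_inv (D_mat idx i1 d x)) ` closure (Omega A a b))"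
    and H1: "W1 \<in> H1h_space A a b m" "W2 \<in> H1h_space A a b m"
    and sol: "solves_system idx i1 A d a b m \<mu>s K W1" "solves_system idx i1 A d a b m \<mu>s K W2"
    and bd: "\<And>J y. (J, y) \<in> boundary_pts a b m \<Longrightarrow> W1 J y = W2 J y"
    and "J \<in> grid m" "y \<in> {a..b}"
  shows "W1 J y = W2 J y"
proof (cases "J \<in> interior_grid m")
  case False
  then show ?thesis using bd \<open>J \<in> grid m\<close> \<open>y \<in> {a..b}\<close> by (simp add: boundary_pts_def)
next
  case True
  let ?S = "closure (Omega A a b) :: 'n pnt set" and ?I = "interior_grid m :: ('n \<Rightarrow> nat) set"
  define Z where "Z J y = W1 J y - W2 J y" for J y
  define \<sigma> where "\<sigma> y = (\<Sum>J\<in>?I. norm (Z J y))" for y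
  have pos: "0 < snd x" if "x \<in> ?S" for x
    using snd_ge_of_closure_Omega[OF that] \<open>1 < a\<close> by simp
  have step: "step A m > 0" using \<open>A > 0\<close> \<open>m > 1\<close> by (simp add: step_def)
  have AC: "absolutely_continuous_on a b (W1 J)" "absolutely_continuous_on a b (W2 J)" if "J \<in> ?I" for J
    using H1 that by (auto simp: H1h_space_def)
  obtain R1 R2 where R1: "\<forall>J\<in>?I. \<forall>y\<in>{a..b}. norm (W1 J y) \<le> R1"
    and R2: "\<forall>J\<in>?I. \<forall>y\<in>{a..b}. norm (W2 J y) \<le> R2"
    using grid_function_bounded[of m a b W1] grid_function_bounded[of m a b W2] AC by blast
  define R where "R = max R1 R2"
  have R: "norm (W1 J y) \<le> R" "norm (W2 J y) \<le> R" if "J \<in> ?I" "y \<in> {a..b}" for J y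
    using R1 R2 that by (auto simp: R_def le_max_iff_disj)
  obtain L where "L \<ge> 0" and L: "\<And>V W x. norm V \<le> R \<Longrightarrow> norm W \<le> R \<Longrightarrow> x \<in> ?S \<Longrightarrow>
      norm (F_vec idx i1 d \<mu>s K V x - F_vec idx i1 d \<mu>s K W x) \<le> L * norm (V - W)"
    using F_vec_Lipschitz[OF \<open>d > 0\<close> compact_closure_Omega pos K continuous_on_subset[OF \<mu>], of R idx i1]
    by blast
  obtain BD where "BD > 0" and BD: "\<And>x. x \<in> ?S \<Longrightarrow> norm (matrix_inv (D_mat idx i1 d x)) \<le> BD"
    using bdd unfolding bounded_pos by blast
  have "bounded (\<Union>i. A_mat idx i1 d i ` ?S)"
    by (intro bounded_UN finite ballI compact_imp_bounded compact_continuous_image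
        compact_closure_Omega continuous_on_A_mat pos)
  then obtain BA where "BA > 0" and BA: "\<And>i x. x \<in> ?S \<Longrightarrow> norm (A_mat idx i1 d i x) \<le> BA"
    unfolding bounded_pos by blast
  define N where "N = real CARD('N)"
  \<comment> \<open>\<open>N * BD\<close> comes from inverting \<open>D_mat\<close>, the sum over
    the n directions of \<open>N * BA / step A m\<close> from the centred differences, and
    \<open>L\<close> from F.\<close>
  define C where "C = N * BD * (CARD('n) * (N * BA * (1 / step A m)) + L)"
  have "C \<ge> 0"
    using \<open>L \<ge> 0\<close> \<open>BD > 0\<close> \<open>BA > 0\<close> step by (simp add: C_def N_def)
  \<comment> \<open>At a node that is not interior Z vanishes by the boundary condition, so the
    interior sum \<sigma> dominates Z on the whole grid and the inequality closes.\<close>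
  have Z_le: "norm (Z J y) \<le> \<sigma> y" if "J \<in> grid m" "y \<in> {a..b}" for J y
  proof (cases "J \<in> ?I")
    case True
    then show ?thesis unfolding \<sigma>_def by (intro member_le_sum finite_interior_grid) auto
  next
    case False
    then have "Z J y = 0" using bd that by (simp add: Z_def boundary_pts_def)
    then show ?thesis by (simp add: \<sigma>_def sum_nonneg)
  qed
  \<comment> \<open>A purely algebraic estimate at one point: \<open>u1\<close> and
    \<open>u2\<close> stand for the two y-derivatives, whose existence is brought in only
    afterwards, almost everywhere.\<close>
  have estimate: "norm (u1 - u2) \<le> C * \<sigma> y"
    if J: "J \<in> ?I" and y: "y \<in> {a<..<b}" and x: "x = (node A m J, y)"
    and e1: "D_mat idx i1 d x *v u1 + (\<Sum>i\<in>UNIV. A_mat idx i1 d i x *v diff_x A m i W1 J y)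
        + F_vec idx i1 d \<mu>s K (W1 J y) x = 0"
    and e2: "D_mat idx i1 d x *v u2 + (\<Sum>i\<in>UNIV. A_mat idx i1 d i x *v diff_x A m i W2 J y)
        + F_vec idx i1 d \<mu>s K (W2 J y) x = 0"
    for J y u1 u2 x
  proof -
    have xS: "x \<in> ?S" unfolding x
      using node_in_Omega[OF \<open>A > 0\<close> \<open>m > 1\<close> J y] closure_subset by blast
    have y': "y \<in> {a..b}" using y by simp
    let ?f = "F_vec idx i1 d \<mu>s K (W1 J y) x - F_vec idx i1 d \<mu>s K (W2 J y) x"
    let ?s = "\<Sum>i\<in>UNIV. A_mat idx i1 d i x *v diff_x A m i Z J y"
    have s_eq: "?s = (\<Sum>i\<in>UNIV. A_mat idx i1 d i x *v diff_x A m i W1 J y)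
        - (\<Sum>i\<in>UNIV. A_mat idx i1 d i x *v diff_x A m i W2 J y)"
      unfolding Z_def[abs_def] diff_x_diff by (simp add: matrix_vector_mult_diff_distrib sum_subtractf)
    have Du: "D_mat idx i1 d x *v (u1 - u2) = - (?s + ?f)"
    proof -
      have "D_mat idx i1 d x *v u = - (s + f)" if "D_mat idx i1 d x *v u + s + f = 0" for u s f
        using that unfolding eq_neg_iff_add_eq_0 by (simp only: add.assoc)
      from this[OF e1] this[OF e2] s_eq show ?thesis
        by (simp add: matrix_vector_mult_diff_distrib)
    qed
    have "norm ?s \<le> (\<Sum>i\<in>(UNIV :: 'n set). N * BA * (\<sigma> y / step A m))"
    proof (rule sum_norm_le)
      fix i
      have "norm (A_mat idx i1 d i x *v diff_x A m i Z J y)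
          \<le> N * norm (A_mat idx i1 d i x) * norm (diff_x A m i Z J y)"
        unfolding N_def by (rule norm_matrix_vector_mult_le)
      also have "\<dots> \<le> N * BA * (\<sigma> y / step A m)"
        using BA[OF xS] \<open>BA > 0\<close>
        by (intro mult_mono norm_diff_x_le J \<open>m > 1\<close> step Z_le y') (auto simp: N_def)
      finally show "norm (A_mat idx i1 d i x *v diff_x A m i Z J y) \<le> N * BA * (\<sigma> y / step A m)" .
    qed
    moreover have "norm ?f \<le> L * \<sigma> y"
    proof -
      have "norm ?f \<le> L * norm (Z J y)"
        unfolding Z_def by (rule L[OF R[OF J y'] xS])
      also have "\<dots> \<le> L * \<sigma> y"
        using Z_le J y' interior_grid_subset_grid \<open>L \<ge> 0\<close> by (intro mult_left_mono) blast+
      finally show ?thesis .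
    qed
    ultimately have "norm (?s + ?f) \<le> CARD('n) * (N * BA * (\<sigma> y / step A m)) + L * \<sigma> y"
      using norm_triangle_ineq[of ?s ?f] by simp
    also have "\<dots> = (CARD('n) * (N * BA * (1 / step A m)) + L) * \<sigma> y"
      by (simp add: algebra_simps)
    finally have sf: "norm (?s + ?f) \<le> (CARD('n) * (N * BA * (1 / step A m)) + L) * \<sigma> y" .
    have "norm (u1 - u2) \<le> N * norm (matrix_inv (D_mat idx i1 d x)) * norm (?s + ?f)"
      using norm_le_matrix_inv[OF inv[OF xS], of "u1 - u2"] unfolding Du norm_minus_cancel N_def .
    also have "\<dots> \<le> N * BD * ((CARD('n) * (N * BA * (1 / step A m)) + L) * \<sigma> y)"
      using BD[OF xS] \<open>BD > 0\<close> sf by (intro mult_mono) (auto simp: N_def)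
    finally show ?thesis by (simp add: C_def mult.assoc)
  qed
  have der: "AE y in lebesgue_on {a<..<b}. \<forall>J\<in>?I. Z J differentiable (at y) \<and>
      norm (vector_derivative (Z J) (at y)) \<le> C * (\<Sum>J'\<in>?I. norm (Z J' y))"
  proof (subst AE_finite_all[OF finite_interior_grid], rule ballI)
    fix J assume J: "J \<in> ?I"
    have "AE y in lebesgue_on {a<..<b}. y \<in> {a<..<b}"
      by (rule AE_I2) simp
    moreover have "AE y in lebesgue_on {a<..<b}. W1 J differentiable (at y)"
        "AE y in lebesgue_on {a<..<b}. W2 J differentiable (at y)"
      using H1 J by (auto simp: H1h_space_def)
    moreover note sol[unfolded solves_system_def Let_def diff_y_def, rule_format, OF J]
    ultimately show "AE y in lebesgue_on {a<..<b}. Z J differentiable (at y) \<and>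
      norm (vector_derivative (Z J) (at y)) \<le> C * (\<Sum>J'\<in>?I. norm (Z J' y))"
    proof eventually_elim
      case (elim y)
      \<comment> \<open>\<open>vector_derivative\<close> of a difference splits only where both
        solutions are differentiable, hence the two almost-everywhere conditions.\<close>
      have "(Z J has_vector_derivative vector_derivative (W1 J) (at y) - vector_derivative (W2 J) (at y)) (at y)"
        unfolding Z_def[abs_def] using elim(2,3)
        by (intro has_vector_derivative_diff) (simp_all add: vector_derivative_works)
      then show ?case
        using estimate[OF J elim(1) refl elim(4,5)]
        by (metis \<sigma>_def differentiableI_vector vector_derivative_at)
    qed
  qed
  have "Z J y = 0"
  proof (rule gronwall_family_zero[OF finite_interior_grid \<open>C \<ge> 0\<close> _ _ _ der True \<open>y \<in> {a..b}\<close>])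
    show "a \<le> b" using \<open>a < b\<close> by simp
    fix J assume J: "J \<in> ?I"
    show "absolutely_continuous_on a b (Z J)"
      unfolding Z_def[abs_def] by (intro absolutely_continuous_on_diff AC J)
    have "(J, a) \<in> boundary_pts a b m"
      using J interior_grid_subset_grid \<open>a < b\<close> by (auto simp: boundary_pts_def)
    then show "Z J a = 0" by (simp add: Z_def bd)
  qed
  then show ?thesis by (simp add: Z_def)
qed

section \<open>From equality of W to equality of the absorption coefficient\<close>

lemma grad_h_cong:
  assumes "J \<in> interior_grid m" "m > 1" "y \<in> {a<..<b}"
    and eq: "\<And>J y. J \<in> grid m \<Longrightarrow> y \<in> {a..b} \<Longrightarrow> p J y = q J y"
  shows "grad_h A m p J y = grad_h A m q J y"
proof -
  have "diff_x A m k p J y = diff_x A m k q J y" for k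
  proof -
    have "p (J(k := J k + 1)) y = q (J(k := J k + 1)) y" "p (J(k := J k - 1)) y = q (J(k := J k - 1)) y"
      using assms(3) by (auto intro!: eq neighbours_in_grid[OF assms(1,2)] simp del: One_nat_def)
    then show ?thesis unfolding diff_x_def by simp
  qed
  moreover have "diff_y p J y = diff_y q J y"
  proof -
    \<comment> \<open>The derivative in y depends on values near y, not only at y; since y lies in
      the open interval, the two functions agree on a neighbourhood.\<close>
    have "eventually (\<lambda>z. z \<in> {a<..<b}) (nhds y)"
      using assms(3) by (intro eventually_nhds_in_open) auto
    then have "eventually (\<lambda>z. z \<in> UNIV \<longrightarrow> p J z = q J z) (nhds y)"
      by (rule eventually_mono) (use eq assms(1) interior_grid_subset_grid in fastforce)
    then show ?thesis unfolding diff_y_def by (rule vector_derivative_cong_eq) auto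
  qed
  ultimately show ?thesis by (simp add: grad_h_def)
qed

text \<open>The right-hand side of the relation is an explicit expression in W and its discrete
  gradient, so it is the same for both solutions. Equality holds almost everywhere because the
  relation itself is imposed almost everywhere.\<close>

lemma absorption_unique:
  assumes "m > 1" "J \<in> interior_grid m"
    and eq: "\<And>J y. J \<in> grid m \<Longrightarrow> y \<in> {a..b} \<Longrightarrow> W1 J y = W2 J y"
    and rel: "absorption_relation idx i1 A d a b m \<mu>s K W1 ah1" "absorption_relation idx i1 A d a b m \<mu>s K W2 ah2"
  shows "AE y in lebesgue_on {a<..<b}. ah1 J y = ah2 J y"
proof -
  have "AE y in lebesgue_on {a<..<b}. y \<in> {a<..<b}"
    by (rule AE_I2) simp
  moreover note rel[unfolded absorption_relation_def Let_def, rule_format, OF assms(2)]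
  ultimately show ?thesis
  proof eventually_elim
    case (elim y)
    have W: "W1 J y = W2 J y"
      using elim(1) assms(2) interior_grid_subset_grid by (intro eq) auto
    have "grad_h A m (\<lambda>J y. expansion idx d (W1 J y) \<alpha>) J y = grad_h A m (\<lambda>J y. expansion idx d (W2 J y) \<alpha>) J y" for \<alpha>
      by (rule grad_h_cong[OF assms(2,1) elim(1)]) (simp add: eq)
    then show ?case unfolding elim(2,3) W by simp
  qed
qed

theorem theorem4p3:
  fixes idx :: "'N::finite \<Rightarrow> nat" and i1 :: "'n::finite"
    and A d a b a0 h0 :: real and m :: nat
    and \<mu>s :: "'n pnt \<Rightarrow> real"
    and K :: "'n pnt \<times> real \<times> real \<Rightarrow> real"
    and P :: "('n \<Rightarrow> nat) \<Rightarrow> real \<Rightarrow> real^'N"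
    and W1 W2 :: "('n \<Rightarrow> nat) \<Rightarrow> real \<Rightarrow> real^'N"
    and ah1 ah2 :: "('n \<Rightarrow> nat) \<Rightarrow> real \<Rightarrow> real"
  assumes "bij_betw idx UNIV {..<CARD('N)}"
    and "A > 0" and "d > 0" and "1 < a" and "a < b"
    and "m > 1" and "h0 > 0" and "step A m \<ge> h0"
    and "C2_on (closure (Omega A a b) \<times> {-d..d} \<times> {-d..d}) K"
    and "\<forall>p \<in> closure (Omega A a b) \<times> {-d..d} \<times> {-d..d}. K p \<ge> 0"
    and "C2_on UNIV \<mu>s"
    and "\<forall>x. \<mu>s x \<ge> 0"
    and "\<forall>x. x \<notin> Omega A a b \<longrightarrow> \<mu>s x = 0"
    and "admissible_a0 idx i1 A d a0" and "a \<ge> a0"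
    and "is_solution idx i1 A d a b m \<mu>s K P W1 ah1"
    and "is_solution idx i1 A d a b m \<mu>s K P W2 ah2"
  shows "(\<forall>J\<in>grid m. \<forall>y\<in>{a..b}. W1 J y = W2 J y) \<and>
    (\<forall>J\<in>interior_grid m. AE y in lebesgue_on {a<..<b}. ah1 J y = ah2 J y)"
proof -
  note sol1 = assms(16)[unfolded is_solution_def] and sol2 = assms(17)[unfolded is_solution_def]
  have inv: "\<And>x. x \<in> closure (Omega A a b) \<Longrightarrow> invertible (D_mat idx i1 d x)"
    and bdd: "bounded ((\<lambda>x. matrix_inv (D_mat idx i1 d x)) ` closure (Omega A a b))"
    using assms(5,14,15) by (auto simp: admissible_a0_def)
  have W: "W1 J y = W2 J y" if "J \<in> grid m" "y \<in> {a..b}" for J y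
    by (rule solution_diff_zero[OF assms(2,3,4,5,6,9) C2_on_imp_continuous_on[OF assms(11)] inv bdd])
       (use sol1 sol2 that in \<open>auto dest!: bspec\<close>)
  have "AE y in lebesgue_on {a<..<b}. ah1 J y = ah2 J y" if "J \<in> interior_grid m" for J
    by (rule absorption_unique[where ?W1.0 = W1 and ?W2.0 = W2])
       (use assms(6) that W sol1 sol2 in auto)
  with W show ?thesis by blast
qed

end
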